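(* Let $\mathcal{A}=\{H_1,\dots,H_m\}$ be a spanning arrangement of $m>n$ simple toric hyperplanes in general position on $\mathbb{T}^n$, and let $\mathbf{a}_i\in\mathbb{Z}^n$ be the normal vector of $H_i$. Then the number $f_n(\mathcal{A})$ of $n$-dimensional flats of $\mathcal{A}$, i.e. of connected components of $\mathbb{T}^n\setminus\bigcup_{i=1}^mH_i$, is $$f_n(\mathcal{A})=\sum_{\substack{S=\{i_1,\dots,i_n\}\subseteq\{1,\dots,m\}\\|S|=n}}\big|\det(\mathbf{a}_{i_1}\mid\mathbf{a}_{i_2}\mid\dots\mid\mathbf{a}_{i_n})\big|.$$
   Context: $\mathbb{T}^n=\mathbb{R}^n/\mathbb{Z}^n$ and $S^1=\mathbb{R}/\mathbb{Z}$. An (affine toric) hyperplane on $\mathbb{T}^n$ with normal vector $\mathbf{a}\in\mathbb{Z}^n\setminus\{0\}$ and intercept $b\in S^1$ is $\{x\in\mathbb{T}^n:\mathbf{a}\cdot x=b\}$; it is simple if the gcd of the entries of $\mathbf{a}$ is $1$. An arrangement is a finite set of hyperplanes. It is in general position if for all distinct $H_1,\dots,H_r$ in it, $\dim(H_1\cap\dots\cap H_r)\le n-r$ when $r\le n$ (satisfied when the intersection is empty), and $H_1\cap\dots\cap H_r=\emptyset$ when $r>n$. It is spanning if some $n$ of its hyperplanes have non-empty intersection (for general position arrangements, equivalently, the normal vectors of some $n$ of its hyperplanes span $\mathbb{R}^n$). *)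

theory Defs
  imports "HOL-Analysis.Analysis"
begin

definition lattice_equiv :: "real ^ 'n \<Rightarrow> real ^ 'n \<Rightarrow> bool" where
  "lattice_equiv x y \<longleftrightarrow> (\<forall>i. x $ i - y $ i \<in> \<int>)"

lemma equivp_lattice_equiv: "equivp (lattice_equiv :: real ^ 'n \<Rightarrow> real ^ 'n \<Rightarrow> bool)"
proof (rule equivpI)
  show "reflp (lattice_equiv :: real ^ 'n \<Rightarrow> _)"
    by (simp add: reflp_def lattice_equiv_def)
  show "symp (lattice_equiv :: real ^ 'n \<Rightarrow> _)"
    unfolding symp_def lattice_equiv_def by (metis Ints_minus minus_diff_eq)
  show "transp (lattice_equiv :: real ^ 'n \<Rightarrow> _)"
  proof (rule transpI)
    fix x y z :: "real ^ 'n"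
    assume *: "lattice_equiv x y" "lattice_equiv y z"
    have "x $ i - z $ i = (x $ i - y $ i) + (y $ i - z $ i)" for i by simp
    then show "lattice_equiv x z"
      using * unfolding lattice_equiv_def by (metis Ints_add)
  qed
qed

quotient_type (overloaded) 'n torus = "real ^ ('n::finite)" / lattice_equiv
  by (rule equivp_lattice_equiv)

text \<open>The quotient topology; \<^term>\<open>abs_torus\<close> is the projection $\mathbb{R}^n \to \mathbb{T}^n$.\<close>

instantiation torus :: (finite) topological_space
begin

definition open_torus :: "'a torus set \<Rightarrow> bool" where
  "open_torus U \<longleftrightarrow> open (abs_torus -` U)"

instance
  by standard (auto simp: open_torus_def vimage_Int vimage_Union)

end

definition int_equiv :: "real \<Rightarrow> real \<Rightarrow> bool" where
  "int_equiv s t \<longleftrightarrow> s - t \<in> \<int>"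

quotient_type circle = real / int_equiv
proof (rule equivpI)
  show "reflp int_equiv"
    by (simp add: reflp_def int_equiv_def)
  show "symp int_equiv"
    unfolding symp_def int_equiv_def by (metis Ints_minus minus_diff_eq)
  show "transp int_equiv"
  proof (rule transpI)
    fix x y z :: real
    assume *: "int_equiv x y" "int_equiv y z"
    have "x - z = (x - y) + (y - z)" by simp
    then show "int_equiv x z"
      using * unfolding int_equiv_def by (metis Ints_add)
  qed
qed

lift_definition torus_dot :: "int ^ 'n \<Rightarrow> 'n::finite torus \<Rightarrow> circle"
  is "\<lambda>a x. \<Sum>i\<in>UNIV. of_int (a $ i) * x $ i"
proof -
  fix a :: "int ^ 'n" and x y :: "real ^ 'n"
  assume "lattice_equiv x y"
  then have "(\<Sum>i\<in>UNIV. of_int (a $ i) * (x $ i - y $ i)) \<in> \<int>"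
    by (intro Ints_sum Ints_mult) (auto simp: lattice_equiv_def)
  then show "int_equiv (\<Sum>i\<in>UNIV. of_int (a $ i) * x $ i) (\<Sum>i\<in>UNIV. of_int (a $ i) * y $ i)"
    by (simp add: int_equiv_def right_diff_distrib sum_subtractf)
qed

definition toric_hyperplane :: "int ^ 'n \<Rightarrow> circle \<Rightarrow> 'n::finite torus set" where
  "toric_hyperplane a b = {x. torus_dot a x = b}"

definition is_hyperplane_with_normal :: "'n::finite torus set \<Rightarrow> int ^ 'n \<Rightarrow> bool" where
  "is_hyperplane_with_normal H a \<longleftrightarrow> a \<noteq> 0 \<and> (\<exists>b. H = toric_hyperplane a b)"

definition is_simple_hyperplane_with_normal :: "'n::finite torus set \<Rightarrow> int ^ 'n \<Rightarrow> bool" where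
  "is_simple_hyperplane_with_normal H a \<longleftrightarrow>
     is_hyperplane_with_normal H a \<and> Gcd (range (\<lambda>i. a $ i)) = 1"

definition toric_arrangement :: "'n::finite torus set set \<Rightarrow> bool" where
  "toric_arrangement \<A> \<longleftrightarrow> finite \<A> \<and> (\<forall>H\<in>\<A>. \<exists>a. is_hyperplane_with_normal H a)"

text \<open>Dimension of an intersection of toric hyperplanes. The preimage of such a set in
  $\mathbb{R}^n$ is a locally finite disjoint union of parallel affine subspaces, each of which
  covers a connected component of the set. The dimension of the empty set is $-1$. For subsets
  of the torus that are not locally affine this is not a reasonable notion of dimension.\<close>

definition toric_dim :: "'n::finite torus set \<Rightarrow> int" where
  "toric_dim X = Max (insert (-1) (aff_dim ` components (abs_torus -` X)))"

definition general_position :: "'n::finite torus set set \<Rightarrow> bool" where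
  "general_position \<A> \<longleftrightarrow> (\<forall>\<B>\<subseteq>\<A>. \<B> \<noteq> {} \<longrightarrow>
     (card \<B> \<le> CARD('n) \<longrightarrow> toric_dim (\<Inter>\<B>) \<le> int CARD('n) - int (card \<B>)) \<and>
     (card \<B> > CARD('n) \<longrightarrow> \<Inter>\<B> = {}))"

definition spanning :: "'n::finite torus set set \<Rightarrow> bool" where
  "spanning \<A> \<longleftrightarrow> (\<exists>\<B>\<subseteq>\<A>. card \<B> = CARD('n) \<and> \<Inter>\<B> \<noteq> {})"

definition num_regions :: "'n::finite torus set set \<Rightarrow> nat" where
  "num_regions \<A> = card (components (UNIV - \<Union>\<A>))"

text \<open>For a set $S$ of $n$ indices, the absolute determinant of the matrix with the columns
  $a_i$, $i \in S$. The columns of a matrix are indexed by the type \<^typ>\<open>'n\<close>, so that some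
  enumeration of $S$ by \<^typ>\<open>'n\<close> has to be chosen; the value does not depend on it.\<close>

definition abs_det_cols :: "('i \<Rightarrow> int ^ 'n) \<Rightarrow> 'i set \<Rightarrow> int" where
  "abs_det_cols a S =
     (let e = (SOME e :: 'n::finite \<Rightarrow> 'i. bij_betw e UNIV S) in \<bar>det (\<chi> r c. a (e c) $ r)\<bar>)"

lemma abs_det_cols_eq:
  fixes a :: "'i \<Rightarrow> int ^ ('n::finite)" and e :: "'n \<Rightarrow> 'i"
  assumes "bij_betw e UNIV S"
  shows "abs_det_cols a S = \<bar>det (\<chi> r c. a (e c) $ r)\<bar>"
proof -
  define e' where "e' = (SOME e :: 'n \<Rightarrow> 'i. bij_betw e UNIV S)"
  have e': "bij_betw e' UNIV S"
    unfolding e'_def by (rule someI[where P = "\<lambda>e. bij_betw e UNIV S"]) (rule assms)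
  define p where "p = inv_into UNIV e \<circ> e'"
  have "bij_betw p UNIV UNIV"
    unfolding p_def by (rule bij_betw_trans[OF e' bij_betw_inv_into[OF assms]])
  then have p: "p permutes UNIV"
    by (auto intro: bij_imp_permutes)
  have "e (p c) = e' c" for c
    using bij_betw_inv_into_right[OF assms] bij_betwE[OF e'] by (simp add: p_def)
  then have "det (\<chi> r c. a (e' c) $ r) = of_int (sign p) * det (\<chi> r c. a (e c) $ r)"
    using det_permute_columns[OF p, of "\<chi> r c. a (e c) $ r"] by simp
  then show ?thesis
    by (simp add: abs_det_cols_def e'_def[symmetric] abs_mult sign_def)
qed

end

theory Submission
  imports Defs
begin

text \<open>
The number of regions is the number of vertices of the arrangement, that is, of points that lie on
\<open>n\<close> of the hyperplanes. This comes from a sweep with a generic linear height \<open>w\<close>. In the universal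
cover \<open>\<real>^n\<close> the lifted hyperplanes form a periodic grid. Its cells are open convex polytopes,
bounded because the normals span, so the closure of each cell has a lowest point. By genericity
a lowest point is a vertex, and by general position exactly \<open>n\<close> hyperplanes of the grid pass through
a vertex \<open>v\<close>, with linearly independent normals \<open>\<alpha> i\<close>. Write \<open>w\<close> as the sum of the
\<open>c i *\<^sub>R \<alpha> i\<close>; genericity makes all \<open>c i\<close> nonzero. Then \<open>v\<close> is the lowest point of a cell
at \<open>v\<close> if and only if the cell lies on the positive side of the hyperplanes with \<open>c i > 0\<close> and on the
negative side of the others (\<open>lowest_coeff_sign\<close>, \<open>lowest_by_coeffs\<close>). Exactly one of the \<open>2 ^ n\<close>
cells at \<open>v\<close> does so. The resulting bijection between cells and vertices commutes with
translations by \<open>\<int>^n\<close>, and the regions on the torus are the images of the cells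
(\<open>components_complement\<close>), so it descends to a bijection between regions and vertices
(\<open>regions_vertices_bij\<close>).

It remains to count the vertices. Since no point lies on more than \<open>n\<close> hyperplanes, they are
partitioned according to the set \<open>S\<close> of the \<open>n\<close> hyperplanes through them. If the normals of \<open>S\<close> are
dependent, general position forces the intersection to be empty. Otherwise it is the solution set of
\<open>M x \<equiv> b\<close> modulo \<open>\<int>^n\<close> for an integer matrix \<open>M\<close> of nonzero determinant. The number of solutions does not
depend on \<open>b\<close>, and its average over all \<open>b\<close> is the volume of the image of the unit cube under \<open>M\<close>,
which is \<open>\<bar>det M\<bar>\<close> (\<open>card_cube_solutions\<close>, \<open>card_Inter_eq_abs_det\<close>).
\<close>

section \<open>Cells and vertices of a grid of hyperplanes\<close>

text \<open>With prescribed values \<open>0\<close> and \<open>1\<close> this gives the dual basis of the normals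
at a vertex, with prescribed signs a direction that points into one chosen cell at the vertex.\<close>

lemma prescribed_inner:
  fixes \<alpha> :: "'i \<Rightarrow> 'a::euclidean_space"
  assumes "independent (\<alpha> ` J)" "inj_on \<alpha> J"
  obtains d where "\<And>i. i \<in> J \<Longrightarrow> \<alpha> i \<bullet> d = s i"
proof -
  obtain g :: "'a \<Rightarrow> real" where g: "linear g" "\<forall>x\<in>\<alpha> ` J. g x = s (the_inv_into J \<alpha> x)"
    using linear_independent_extend[OF assms(1), of "\<lambda>x. s (the_inv_into J \<alpha> x)"] by blast
  have "\<alpha> i \<bullet> adjoint g 1 = s i" if "i \<in> J" for i
    using g that assms(2) by (simp add: adjoint_works the_inv_into_f_f)
  then show thesis by (rule that)
qed

text \<open>A linear constraint survives a small step: a slack one because it is open, an active one because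
the direction points into its half-space.\<close>

lemma eventually_less_along_ray:
  fixes t :: real
  assumes "lo \<le> t" "t = lo \<Longrightarrow> 0 < s"
  shows "\<forall>\<^sub>F \<epsilon> in at_right 0. lo < t + \<epsilon> * s"
proof (cases "t = lo")
  case True
  show ?thesis
    using eventually_at_right_less[of "0::real"] by eventually_elim (use True assms in auto)
next
  case False
  have "((\<lambda>\<epsilon>. t + \<epsilon> * s) \<longlongrightarrow> t + 0 * s) (at_right 0)"
    by (intro tendsto_intros)
  then show ?thesis
    using order_tendstoD(1)[of _ "t + 0 * s" "at_right 0" lo] False assms by simp
qed

lemma eventually_le_along_ray:
  fixes t :: real
  assumes "lo \<le> t" "t = lo \<Longrightarrow> 0 \<le> s"
  shows "\<forall>\<^sub>F \<epsilon> in at_right 0. lo \<le> t + \<epsilon> * s"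
proof (cases "t = lo")
  case True
  show ?thesis
    using eventually_at_right_less[of "0::real"] by eventually_elim (use True assms in auto)
next
  case False
  then have "\<forall>\<^sub>F \<epsilon> in at_right 0. lo < t + \<epsilon> * s"
    using assms by (intro eventually_less_along_ray) auto
  then show ?thesis by eventually_elim simp
qed

text \<open>The lift of a toric arrangement: the index \<open>i\<close> stands for all the parallel hyperplanes
\<open>\<alpha> i \<bullet> x \<in> \<beta> i + \<int>\<close>, the preimage of one toric hyperplane. General position enters only
as the linear independence of the normals through each point. The last assumption says that
\<open>w\<close> is a generic height: it is constant on no positive-dimensional intersection of
hyperplanes of the grid, and all its coefficients in a basis of normals are nonzero.\<close>

locale hyperplane_grid =
  fixes I :: "'i set" and \<alpha> :: "'i \<Rightarrow> 'a::euclidean_space" and \<beta> :: "'i \<Rightarrow> real" and w :: 'a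
  assumes finite_I: "finite I"
    and span_normals: "span (\<alpha> ` I) = UNIV"
    and indep_tight: "\<And>v. independent (\<alpha> ` {i\<in>I. \<alpha> i \<bullet> v - \<beta> i \<in> \<int>})"
    and inj_tight: "\<And>v. inj_on \<alpha> {i\<in>I. \<alpha> i \<bullet> v - \<beta> i \<in> \<int>}"
    and generic: "\<And>J. J \<subseteq> I \<Longrightarrow> dim (\<alpha> ` J) < DIM('a) \<Longrightarrow> w \<notin> span (\<alpha> ` J)"
begin

definition level :: "'i \<Rightarrow> 'a \<Rightarrow> real" where
  "level i x = \<alpha> i \<bullet> x - \<beta> i"

definition tight :: "'a \<Rightarrow> 'i set" where
  "tight x = {i\<in>I. level i x \<in> \<int>}"

definition cell :: "('i \<Rightarrow> int) \<Rightarrow> 'a set" where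
  "cell f = {x. \<forall>i\<in>I. of_int (f i) < level i x \<and> level i x < of_int (f i) + 1}"

text \<open>For a nonempty \<open>cell f\<close> this is its closure. Taking the weak inequalities as the definition
turns optimality at a point into a condition on the active inequalities.\<close>

definition closed_cell :: "('i \<Rightarrow> int) \<Rightarrow> 'a set" where
  "closed_cell f = {x. \<forall>i\<in>I. of_int (f i) \<le> level i x \<and> level i x \<le> of_int (f i) + 1}"

definition lowest :: "('i \<Rightarrow> int) \<Rightarrow> 'a \<Rightarrow> bool" where
  "lowest f v \<longleftrightarrow> v \<in> closed_cell f \<and> (\<forall>x\<in>closed_cell f. w \<bullet> v \<le> w \<bullet> x)"

lemma level_add: "level i (x + d) = level i x + \<alpha> i \<bullet> d"
  by (simp add: level_def inner_add_right)

lemma tight_subset: "tight v \<subseteq> I"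
  by (auto simp: tight_def)

lemma finite_tight: "finite (tight v)"
  using tight_subset finite_I by (rule finite_subset)

lemma tight_independent: "independent (\<alpha> ` tight v)" "inj_on \<alpha> (tight v)"
  using indep_tight[of v] inj_tight[of v] by (auto simp: tight_def level_def)

lemma dim_tight: "dim (\<alpha> ` tight v) = card (tight v)"
  using dim_eq_card_independent[OF tight_independent(1)] card_image[OF tight_independent(2)]
  by metis

lemma card_tight_le: "card (tight v) \<le> DIM('a)"
  using dim_tight[of v] dim_subset_UNIV[of "\<alpha> ` tight v"] by simp

text \<open>Inside a closed cell an integral level can only be one of its two end values. Hence the active
inequalities at a point are given by the hyperplanes of the whole grid through it, and general
position applies to them.\<close>

lemma tight_in_closed_cell:
  assumes "v \<in> closed_cell f" "i \<in> I"
  shows "i \<in> tight v \<longleftrightarrow> level i v = of_int (f i) \<or> level i v = of_int (f i) + 1"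
proof
  assume "i \<in> tight v"
  then obtain k where "level i v = of_int k" by (auto simp: tight_def elim: Ints_cases)
  moreover have "of_int (f i) \<le> level i v" "level i v \<le> of_int (f i) + 1"
    using assms by (auto simp: closed_cell_def)
  ultimately show "level i v = of_int (f i) \<or> level i v = of_int (f i) + 1"
    by auto
qed (use assms in \<open>auto simp: tight_def\<close>)

text \<open>The functionals that are bounded on a closed cell form a subspace. It contains the normals, which
span.\<close>

lemma bounded_closed_cell: "bounded (closed_cell f)"
proof -
  have "subspace {e. bounded ((\<lambda>x. e \<bullet> x) ` closed_cell f)}"
    unfolding subspace_def
  proof (safe, goal_cases)
    case 1
    have "(\<lambda>x. 0 \<bullet> x) ` closed_cell f \<subseteq> {0}" by auto
    then show ?case by (rule bounded_subset[rotated]) simp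
  next
    case (2 d e)
    then show ?case
      using bounded_plus_comp[of "\<lambda>x. d \<bullet> x" "closed_cell f" "\<lambda>x. e \<bullet> x"]
      by (simp add: inner_add_left)
  next
    case (3 c e)
    then show ?case
      using bounded_scaling[of "(\<lambda>x. e \<bullet> x) ` closed_cell f" c] by (simp add: image_image)
  qed
  moreover have "bounded ((\<lambda>x. \<alpha> i \<bullet> x) ` closed_cell f)" if "i \<in> I" for i
  proof (rule bounded_subset)
    show "bounded {of_int (f i) + \<beta> i .. of_int (f i) + 1 + \<beta> i}" by simp
    show "(\<lambda>x. \<alpha> i \<bullet> x) ` closed_cell f \<subseteq> {of_int (f i) + \<beta> i .. of_int (f i) + 1 + \<beta> i}"
      using that by (auto simp: closed_cell_def level_def algebra_simps)
  qed
  ultimately have "span (\<alpha> ` I) \<subseteq> {e. bounded ((\<lambda>x. e \<bullet> x) ` closed_cell f)}"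
    by (intro span_minimal) auto
  then have *: "bounded ((\<lambda>x. e \<bullet> x) ` closed_cell f)" for e
    using span_normals by auto
  then have "\<exists>B. \<forall>x\<in>closed_cell f. \<bar>e \<bullet> x\<bar> \<le> B" for e
    using *[of e] by (auto simp: bounded_iff)
  then obtain B where B: "\<And>e x. x \<in> closed_cell f \<Longrightarrow> \<bar>e \<bullet> x\<bar> \<le> B e"
    by metis
  have "norm x \<le> (\<Sum>e\<in>Basis. B e)" if "x \<in> closed_cell f" for x
  proof -
    have "norm x \<le> (\<Sum>e\<in>Basis. \<bar>x \<bullet> e\<bar>)" by (rule norm_le_l1)
    also have "\<dots> \<le> (\<Sum>e\<in>Basis. B e)"
      by (intro sum_mono) (use B[OF that] in \<open>simp add: inner_commute\<close>)
    finally show ?thesis .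
  qed
  then show ?thesis by (auto simp: bounded_iff)
qed

lemma cell_subset_closed_cell: "cell f \<subseteq> closed_cell f"
  by (auto simp: cell_def closed_cell_def intro: less_imp_le)

lemma compact_closed_cell: "compact (closed_cell f)"
proof -
  have "closed_cell f =
      (\<Inter>i\<in>I. {x. of_int (f i) + \<beta> i \<le> \<alpha> i \<bullet> x} \<inter> {x. \<alpha> i \<bullet> x \<le> of_int (f i) + 1 + \<beta> i})"
    by (auto simp: closed_cell_def level_def algebra_simps)
  also have "closed \<dots>"
    by (intro closed_INT closed_Int ballI closed_Collect_le continuous_intros)
  finally show ?thesis
    using bounded_closed_cell by (simp add: compact_eq_bounded_closed)
qed

lemma open_cell: "open (cell f)"
proof -
  have "cell f = (\<Inter>i\<in>I. {x. of_int (f i) < level i x} \<inter> {x. level i x < of_int (f i) + 1})"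
    by (auto simp: cell_def)
  also have "open \<dots>"
    unfolding level_def
    by (intro open_INT open_Int ballI finite_I open_Collect_less continuous_intros)
  finally show ?thesis .
qed

lemma convex_cell: "convex (cell f)"
proof -
  have "cell f = (\<Inter>i\<in>I. {x. \<alpha> i \<bullet> x > of_int (f i) + \<beta> i} \<inter> {x. \<alpha> i \<bullet> x < of_int (f i) + 1 + \<beta> i})"
    by (auto simp: cell_def level_def algebra_simps)
  also have "convex \<dots>"
    by (intro convex_INT convex_Int ballI convex_halfspace_lt convex_halfspace_gt)
  finally show ?thesis .
qed

lemma floors_eq_if_meet:
  assumes "x \<in> cell f" "x \<in> cell g" "i \<in> I"
  shows "f i = g i"
proof -
  have "of_int (f i) < (of_int (g i) + 1 :: real)" "of_int (g i) < (of_int (f i) + 1 :: real)"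
    using assms unfolding cell_def by fastforce+
  then show ?thesis by linarith
qed

lemma cell_eq_if_meet:
  assumes "x \<in> cell f" "x \<in> cell g"
  shows "cell f = cell g"
  using floors_eq_if_meet[OF assms] by (auto simp: cell_def)

lemma lowest_eq_if_meet:
  assumes "x \<in> cell f" "x \<in> cell g"
  shows "lowest f v \<longleftrightarrow> lowest g v"
proof -
  have "closed_cell f = closed_cell g"
    using floors_eq_if_meet[OF assms] by (auto simp: closed_cell_def)
  then show ?thesis by (simp add: lowest_def)
qed

lemma lowest_exists:
  assumes "cell f \<noteq> {}"
  obtains v where "lowest f v"
proof -
  have "closed_cell f \<noteq> {}"
    using assms cell_subset_closed_cell by blast
  moreover have "continuous_on (closed_cell f) (\<lambda>x. w \<bullet> x)"
    by (intro continuous_intros)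
  ultimately obtain v where "v \<in> closed_cell f" "\<forall>x\<in>closed_cell f. w \<bullet> v \<le> w \<bullet> x"
    using continuous_attains_inf[OF compact_closed_cell] by blast
  then show thesis using that by (auto simp: lowest_def)
qed

text \<open>The first-order condition: a direction that leaves no active half-space stays in the closed cell
for a small step, so it cannot decrease the height.\<close>

lemma lowest_feasible_direction:
  assumes "lowest f v"
    and lo: "\<And>i. i \<in> tight v \<Longrightarrow> level i v = of_int (f i) \<Longrightarrow> 0 \<le> \<alpha> i \<bullet> d"
    and hi: "\<And>i. i \<in> tight v \<Longrightarrow> level i v = of_int (f i) + 1 \<Longrightarrow> \<alpha> i \<bullet> d \<le> 0"
  shows "0 \<le> w \<bullet> d"
proof -
  have v: "v \<in> closed_cell f" using assms by (simp add: lowest_def)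
  have "\<forall>\<^sub>F \<epsilon> in at_right 0. of_int (f i) \<le> level i (v + \<epsilon> *\<^sub>R d)
      \<and> level i (v + \<epsilon> *\<^sub>R d) \<le> of_int (f i) + 1" if i: "i \<in> I" for i
  proof (rule eventually_conj)
    have bds: "of_int (f i) \<le> level i v" "level i v \<le> of_int (f i) + 1"
      using v i by (auto simp: closed_cell_def)
    show "\<forall>\<^sub>F \<epsilon> in at_right 0. of_int (f i) \<le> level i (v + \<epsilon> *\<^sub>R d)"
      using eventually_le_along_ray[OF bds(1), of "\<alpha> i \<bullet> d"] lo tight_in_closed_cell[OF v i]
      by (simp add: level_add)
    have "\<forall>\<^sub>F \<epsilon> in at_right 0. - (of_int (f i) + 1) \<le> - level i v + \<epsilon> * (- (\<alpha> i \<bullet> d))"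
      using bds hi tight_in_closed_cell[OF v i]
      by (intro eventually_le_along_ray) auto
    then show "\<forall>\<^sub>F \<epsilon> in at_right 0. level i (v + \<epsilon> *\<^sub>R d) \<le> of_int (f i) + 1"
      by eventually_elim (simp add: level_add)
  qed
  then have "\<forall>\<^sub>F \<epsilon> in at_right 0. v + \<epsilon> *\<^sub>R d \<in> closed_cell f"
    using finite_I by (simp add: closed_cell_def eventually_ball_finite_distrib)
  then have "\<forall>\<^sub>F \<epsilon> in at_right (0::real). 0 < \<epsilon> \<and> v + \<epsilon> *\<^sub>R d \<in> closed_cell f"
    by (intro eventually_conj eventually_at_right_less)
  then obtain \<epsilon> :: real where "0 < \<epsilon>" "v + \<epsilon> *\<^sub>R d \<in> closed_cell f"
    using eventually_happens trivial_limit_at_right_real by blast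
  then have "0 \<le> \<epsilon> * (w \<bullet> d)"
    using assms(1) by (fastforce simp: lowest_def inner_add_right)
  then show ?thesis using \<open>0 < \<epsilon>\<close> by (simp add: zero_le_mult_iff)
qed

text \<open>With fewer than \<open>n\<close> hyperplanes through \<open>v\<close>, genericity provides a direction that stays in
all of them and along which \<open>w\<close> strictly decreases.\<close>

lemma lowest_imp_vertex:
  assumes "lowest f v"
  shows "card (tight v) = DIM('a)"
proof (rule ccontr)
  assume "card (tight v) \<noteq> DIM('a)"
  then have w: "w \<notin> span (\<alpha> ` tight v)"
    using card_tight_le[of v] by (intro generic tight_subset) (simp add: dim_tight)
  have ind: "independent (insert w (\<alpha> ` tight v))"
    using w tight_independent(1) by (intro independent_insertI) auto
  obtain g :: "'a \<Rightarrow> real" where g: "linear g"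
    and g_eq: "\<forall>x\<in>insert w (\<alpha> ` tight v). g x = (if x = w then -1 else 0)"
    using linear_independent_extend[OF ind, of "\<lambda>x. if x = w then -1 else (0::real)"] by blast
  have gw: "g w = -1" using g_eq by simp
  have g\<alpha>: "g (\<alpha> i) = 0" if "i \<in> tight v" for i
  proof -
    have "\<alpha> i \<noteq> w" using w span_base[of "\<alpha> i" "\<alpha> ` tight v"] that by blast
    then show ?thesis using g_eq that by simp
  qed
  have "0 \<le> w \<bullet> adjoint g 1"
    by (rule lowest_feasible_direction[OF assms]) (use g g\<alpha> in \<open>simp_all add: adjoint_works\<close>)
  then show False using g gw by (simp add: adjoint_works)
qed

lemma vertex_coeffs:
  assumes "card (tight v) = DIM('a)"
  obtains c where "w = (\<Sum>i\<in>tight v. c i *\<^sub>R \<alpha> i)"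
proof -
  have "dim (\<alpha> ` tight v) = DIM('a)" using assms by (simp add: dim_tight)
  then have "span (\<alpha> ` tight v) = UNIV" by (simp add: dim_eq_full)
  then have "w \<in> span (\<alpha> ` tight v)" by simp
  then obtain u where "w = (\<Sum>x\<in>\<alpha> ` tight v. u x *\<^sub>R x)"
    using finite_tight by (auto simp: span_finite)
  then have "w = (\<Sum>i\<in>tight v. u (\<alpha> i) *\<^sub>R \<alpha> i)"
    using tight_independent(2) by (simp add: sum.reindex)
  then show thesis by (rule that)
qed

lemma vertex_coeff_nonzero:
  assumes w: "w = (\<Sum>i\<in>tight v. c i *\<^sub>R \<alpha> i)" and i: "i \<in> tight v"
  shows "c i \<noteq> 0"
proof
  assume "c i = 0"
  then have "w = (\<Sum>j\<in>tight v - {i}. c j *\<^sub>R \<alpha> j)"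
    using w i finite_tight by (simp add: sum.remove)
  also have "\<dots> \<in> span (\<alpha> ` (tight v - {i}))"
    by (intro span_sum span_scale span_base) simp
  finally have "w \<in> span (\<alpha> ` (tight v - {i}))" .
  moreover have "dim (\<alpha> ` (tight v - {i})) < DIM('a)"
  proof -
    have "dim (\<alpha> ` (tight v - {i})) \<le> card (\<alpha> ` (tight v - {i}))"
      using finite_tight by (intro dim_le_card') auto
    also have "\<dots> \<le> card (tight v - {i})"
      using finite_tight by (intro card_image_le) auto
    also have "\<dots> < card (tight v)"
      using i finite_tight by (intro psubset_card_mono) auto
    finally show ?thesis using card_tight_le[of v] by simp
  qed
  ultimately show False
    using generic[of "tight v - {i}"] tight_subset[of v] by blast
qed

text \<open>Testing the first-order condition with the dual basis vector of \<open>\<alpha> i\<close> shows that the sign of the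
coefficient \<open>c i\<close> decides on which side of the \<open>i\<close>-th hyperplane the cell lies. This is why a
vertex is the lowest point of at most one cell.\<close>

lemma lowest_coeff_sign:
  assumes f: "lowest f v" and w: "w = (\<Sum>i\<in>tight v. c i *\<^sub>R \<alpha> i)" and i: "i \<in> tight v"
  shows "level i v = of_int (f i) \<and> 0 < c i \<or> level i v = of_int (f i) + 1 \<and> c i < 0"
proof -
  obtain d where d: "\<And>j. j \<in> tight v \<Longrightarrow> \<alpha> j \<bullet> d = (if j = i then 1 else 0)"
    using prescribed_inner[OF tight_independent, of v "\<lambda>j. if j = i then 1 else 0"] by blast
  have "w \<bullet> d = (\<Sum>j\<in>tight v. c j * (\<alpha> j \<bullet> d))"
    by (subst w) (simp add: inner_sum_left)
  also have "\<dots> = (\<Sum>j\<in>tight v. if j = i then c j else 0)"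
    by (intro sum.cong) (auto simp: d)
  finally have wd: "w \<bullet> d = c i" using i finite_tight by simp
  have v: "v \<in> closed_cell f" using f by (simp add: lowest_def)
  have "i \<in> I" using i tight_subset by blast
  then consider "level i v = of_int (f i)" | "level i v = of_int (f i) + 1"
    using tight_in_closed_cell[OF v] i by blast
  then show ?thesis
  proof cases
    case 1
    have "0 \<le> w \<bullet> d"
      by (rule lowest_feasible_direction[OF f]) (use d 1 in \<open>auto split: if_splits\<close>)
    then show ?thesis using 1 wd vertex_coeff_nonzero[OF w i] by simp
  next
    case 2
    have "0 \<le> w \<bullet> (- d)"
      by (rule lowest_feasible_direction[OF f]) (use d 2 in \<open>auto split: if_splits\<close>)
    then show ?thesis using 2 wd vertex_coeff_nonzero[OF w i] by simp
  qed
qed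

text \<open>The converse of the sign condition, which is weak linear programming duality: the height above
\<open>v\<close> is a sum of nonnegative terms, one for each hyperplane through \<open>v\<close>, and it vanishes only
if \<open>x\<close> lies on all of them.\<close>

lemma lowest_by_coeffs:
  assumes v: "v \<in> closed_cell f" "card (tight v) = DIM('a)"
    and w: "w = (\<Sum>i\<in>tight v. c i *\<^sub>R \<alpha> i)"
    and sign: "\<And>i. i \<in> tight v \<Longrightarrow>
      level i v = of_int (f i) \<and> 0 < c i \<or> level i v = of_int (f i) + 1 \<and> c i < 0"
    and x: "x \<in> closed_cell f"
  shows "w \<bullet> v \<le> w \<bullet> x" and "w \<bullet> x = w \<bullet> v \<Longrightarrow> x = v"
proof -
  have wx: "w \<bullet> x - w \<bullet> v = (\<Sum>i\<in>tight v. c i * (level i x - level i v))"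
    by (subst (1 2) w)
       (simp add: inner_sum_left level_def right_diff_distrib flip: sum_subtractf)
  have pos: "0 \<le> c i * (level i x - level i v)" if "i \<in> tight v" for i
  proof -
    have "of_int (f i) \<le> level i x" "level i x \<le> of_int (f i) + 1"
      using x that tight_subset by (auto simp: closed_cell_def)
    then show ?thesis using sign[OF that] by (auto intro: mult_nonpos_nonpos)
  qed
  then have "0 \<le> (\<Sum>i\<in>tight v. c i * (level i x - level i v))" by (rule sum_nonneg)
  then show "w \<bullet> v \<le> w \<bullet> x" using wx by simp
  assume "w \<bullet> x = w \<bullet> v"
  then have "\<forall>i\<in>tight v. c i * (level i x - level i v) = 0"
    using wx pos finite_tight by (simp add: sum_nonneg_eq_0_iff)
  moreover have "c i \<noteq> 0" if "i \<in> tight v" for i using sign[OF that] by auto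
  ultimately have orth: "orthogonal (x - v) a" if "a \<in> \<alpha> ` tight v" for a
    using that by (auto simp: level_def orthogonal_def inner_diff_right inner_commute)
  have "dim (\<alpha> ` tight v) = DIM('a)" using v(2) by (simp add: dim_tight)
  then have "x - v \<in> span (\<alpha> ` tight v)" by (simp add: dim_eq_full)
  then have "orthogonal (x - v) (x - v)" using orth by (rule orthogonal_to_span)
  then show "x = v" by (simp add: orthogonal_self)
qed

lemma lowest_unique:
  assumes "lowest f v" "lowest f v'"
  shows "v' = v"
proof -
  have n: "card (tight v) = DIM('a)" by (rule lowest_imp_vertex[OF assms(1)])
  then obtain c where c: "w = (\<Sum>i\<in>tight v. c i *\<^sub>R \<alpha> i)" by (rule vertex_coeffs)
  show ?thesis
    by (rule lowest_by_coeffs(2)[OF _ n c lowest_coeff_sign[OF assms(1) c]])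
       (use assms in \<open>auto simp: lowest_def intro!: antisym\<close>)
qed

lemma lowest_determines_cell:
  assumes "lowest f v" "lowest g v"
  shows "cell f = cell g"
proof -
  have n: "card (tight v) = DIM('a)" by (rule lowest_imp_vertex[OF assms(1)])
  then obtain c where c: "w = (\<Sum>i\<in>tight v. c i *\<^sub>R \<alpha> i)" by (rule vertex_coeffs)
  have "f i = g i" if i: "i \<in> I" for i
  proof (cases "i \<in> tight v")
    case True
    then show ?thesis
      using lowest_coeff_sign[OF assms(1) c True] lowest_coeff_sign[OF assms(2) c True] by auto
  next
    case False
    have "v \<in> closed_cell f" "v \<in> closed_cell g" using assms by (auto simp: lowest_def)
    then have "of_int (f i) < level i v \<and> level i v < of_int (f i) + 1"
      "of_int (g i) < level i v \<and> level i v < of_int (g i) + 1"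
      using False tight_in_closed_cell[of v f i] tight_in_closed_cell[of v g i] i
      by (auto simp: closed_cell_def order_less_le)
    then show ?thesis by linarith
  qed
  then show ?thesis by (auto simp: cell_def)
qed

text \<open>Of the \<open>2 ^ n\<close> cells around a vertex, the one on the side of each hyperplane that the sign of
\<open>c i\<close> requires. It is nonempty since a short step from \<open>v\<close> in a direction with these signs
enters it.\<close>

lemma vertex_is_lowest:
  assumes n: "card (tight v) = DIM('a)"
  obtains f where "cell f \<noteq> {}" "lowest f v"
proof -
  obtain c where c: "w = (\<Sum>i\<in>tight v. c i *\<^sub>R \<alpha> i)" using n by (rule vertex_coeffs)
  obtain d where d: "\<And>j. j \<in> tight v \<Longrightarrow> \<alpha> j \<bullet> d = sgn (c j)"
    using prescribed_inner[OF tight_independent, of v "\<lambda>j. sgn (c j)"] by blast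
  \<comment> \<open>A tight level is an integer: it is the lower end of the cell for a positive coefficient
    and the upper end for a negative one.\<close>
  define f where "f i = (if i \<in> tight v \<and> c i < 0 then \<lfloor>level i v\<rfloor> - 1 else \<lfloor>level i v\<rfloor>)" for i
  have tight_f: "level i v = of_int (f i) \<and> 0 < c i \<or> level i v = of_int (f i) + 1 \<and> c i < 0"
    if "i \<in> tight v" for i
    using that vertex_coeff_nonzero[OF c that] by (auto simp: f_def tight_def elim!: Ints_cases)
  have slack_f: "of_int (f i) < level i v \<and> level i v < of_int (f i) + 1"
    if "i \<in> I" "i \<notin> tight v" for i
  proof -
    have "level i v \<noteq> of_int \<lfloor>level i v\<rfloor>" using that Ints_of_int 
      by (metis (mono_tags, lifting) mem_Collect_eq tight_def)
    moreover have "of_int \<lfloor>level i v\<rfloor> \<le> level i v" "level i v < of_int \<lfloor>level i v\<rfloor> + 1"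
      by linarith+
    ultimately show ?thesis using that unfolding f_def by (smt (verit))
  qed
  have v: "v \<in> closed_cell f"
    unfolding closed_cell_def using tight_f slack_f by (fastforce intro: less_imp_le)
  have low: "lowest f v"
    using v lowest_by_coeffs(1)[OF v n c tight_f] by (auto simp: lowest_def)
  have "\<forall>\<^sub>F \<epsilon> in at_right 0. of_int (f i) < level i (v + \<epsilon> *\<^sub>R d)
      \<and> level i (v + \<epsilon> *\<^sub>R d) < of_int (f i) + 1" if i: "i \<in> I" for i
  proof (rule eventually_conj)
    have bds: "of_int (f i) \<le> level i v" "level i v \<le> of_int (f i) + 1"
      using v i by (auto simp: closed_cell_def)
    show "\<forall>\<^sub>F \<epsilon> in at_right 0. of_int (f i) < level i (v + \<epsilon> *\<^sub>R d)"
      using eventually_less_along_ray[OF bds(1), of "\<alpha> i \<bullet> d"] tight_f[of i] d[of i]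
        tight_in_closed_cell[OF v i]
      by (auto simp: level_add)
    have "\<forall>\<^sub>F \<epsilon> in at_right 0. - (of_int (f i) + 1) < - level i v + \<epsilon> * (- (\<alpha> i \<bullet> d))"
      using bds tight_f[of i] d[of i] tight_in_closed_cell[OF v i]
      by (intro eventually_less_along_ray) auto
    then show "\<forall>\<^sub>F \<epsilon> in at_right 0. level i (v + \<epsilon> *\<^sub>R d) < of_int (f i) + 1"
      by eventually_elim (simp add: level_add)
  qed
  then have "\<forall>\<^sub>F \<epsilon> in at_right 0. v + \<epsilon> *\<^sub>R d \<in> cell f"
    using finite_I by (simp add: cell_def eventually_ball_finite_distrib)
  then obtain \<epsilon> :: real where "v + \<epsilon> *\<^sub>R d \<in> cell f"
    using eventually_happens trivial_limit_at_right_real by blast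
  then show thesis using low that by blast
qed

text \<open>Heights of all points change by the same amount under a translation, so lowest points go
to lowest points.\<close>

lemma cell_translate:
  assumes k: "\<And>i. i \<in> I \<Longrightarrow> \<alpha> i \<bullet> k \<in> \<int>"
  shows "\<exists>g. cell g = (+) k ` cell f \<and> (\<forall>v. lowest f v \<longrightarrow> lowest g (v + k))"
proof -
  define g where "g i = f i + \<lfloor>\<alpha> i \<bullet> k\<rfloor>" for i
  have g: "real_of_int (g i) = of_int (f i) + \<alpha> i \<bullet> k" if "i \<in> I" for i
    using k[OF that] by (auto simp: g_def elim: Ints_cases)
  have shift: "x + k \<in> cell g \<longleftrightarrow> x \<in> cell f" "x + k \<in> closed_cell g \<longleftrightarrow> x \<in> closed_cell f" for x
    by (auto simp: cell_def closed_cell_def level_add g)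
  have "x \<in> (+) k ` cell f" if "x \<in> cell g" for x
    using that shift(1)[of "x - k"] by (intro image_eqI[of _ _ "x - k"]) auto
  moreover have "(+) k ` cell f \<subseteq> cell g"
    using shift(1) by (auto simp: add.commute)
  ultimately have "cell g = (+) k ` cell f" by blast
  moreover have "lowest g (v + k)" if "lowest f v" for v
    unfolding lowest_def
  proof (intro conjI ballI)
    show "v + k \<in> closed_cell g" using that shift by (simp add: lowest_def)
    fix x assume "x \<in> closed_cell g"
    then have "x - k \<in> closed_cell f" using shift(2)[of "x - k"] by simp
    then have "w \<bullet> v \<le> w \<bullet> (x - k)" using that by (simp add: lowest_def)
    then show "w \<bullet> (v + k) \<le> w \<bullet> x" by (simp add: inner_add_right inner_diff_right)
  qed
  ultimately show ?thesis by blast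
qed

end

section \<open>The torus and its projection\<close>

lemma abs_torus_eq_iff: "abs_torus x = abs_torus y \<longleftrightarrow> (\<forall>i. (x - y) $ i \<in> \<int>)"
  by (simp add: torus.abs_eq_iff lattice_equiv_def)

lemma abs_torus_surj: obtains x where "p = abs_torus x"
  by (metis torus.abs_eq_iff Quotient3_abs_rep Quotient3_torus)

lemma continuous_on_abs_torus: "continuous_on S (abs_torus :: real ^ 'n \<Rightarrow> 'n::finite torus)"
proof -
  have "continuous_on UNIV (abs_torus :: real ^ 'n \<Rightarrow> 'n torus)"
    by (simp add: continuous_on_open_vimage open_torus_def)
  then show ?thesis using continuous_on_subset by blast
qed

lemma open_abs_torus_image:
  fixes U :: "(real ^ 'n::finite) set"
  assumes "open U"
  shows "open (abs_torus ` U)"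
proof -
  have "abs_torus -` (abs_torus ` U) = (\<Union>k\<in>{k. \<forall>i. k $ i \<in> \<int>}. (+) k ` U)"
  proof safe
    fix x y :: "real ^ 'n" assume "abs_torus x = abs_torus y" "y \<in> U"
    then show "x \<in> (\<Union>k\<in>{k. \<forall>i. k $ i \<in> \<int>}. (+) k ` U)"
      by (intro UN_I[of "x - y"]) (auto simp: abs_torus_eq_iff intro!: image_eqI[of _ _ y])
  next
    fix k y :: "real ^ 'n" assume "\<forall>i. k $ i \<in> \<int>" "y \<in> U"
    then show "k + y \<in> abs_torus -` abs_torus ` U"
      by (auto simp: abs_torus_eq_iff intro!: image_eqI[of _ _ y])
  qed
  also have "open \<dots>" using assms by (intro open_UN ballI open_translation)
  finally show ?thesis by (simp add: open_torus_def)
qed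

text \<open>A component meeting \<open>C\<close> cannot leave it, because \<open>C\<close> and the union of the other members are
disjoint open sets.\<close>

lemma components_disjoint_open_connected:
  assumes "\<And>C. C \<in> \<C> \<Longrightarrow> open C \<and> connected C \<and> C \<noteq> {}"
    and disj: "\<And>C D. C \<in> \<C> \<Longrightarrow> D \<in> \<C> \<Longrightarrow> C \<inter> D \<noteq> {} \<Longrightarrow> C = D"
  shows "components (\<Union>\<C>) = \<C>"
proof -
  have comp: "connected_component_set (\<Union>\<C>) x = C" if "C \<in> \<C>" "x \<in> C" for C x
  proof (rule equalityI)
    let ?T = "connected_component_set (\<Union>\<C>) x"
    have x: "x \<in> ?T" using that by auto
    have "C \<inter> ?T = {} \<or> \<Union>(\<C> - {C}) \<inter> ?T = {}"
    proof (rule connectedD)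
      show "open C" "open (\<Union>(\<C> - {C}))" using assms that by auto
      show "C \<inter> \<Union>(\<C> - {C}) \<inter> ?T = {}" using disj that by blast
      show "?T \<subseteq> C \<union> \<Union>(\<C> - {C})" using connected_component_subset[of "\<Union>\<C>" x] by blast
    qed simp
    then have "\<Union>(\<C> - {C}) \<inter> ?T = {}" using x that by blast
    then show "?T \<subseteq> C" using connected_component_subset[of "\<Union>\<C>" x] by blast
    show "C \<subseteq> ?T" using assms that by (intro connected_component_maximal) auto
  qed
  show ?thesis
  proof (intro equalityI subsetI)
    fix T assume "T \<in> components (\<Union>\<C>)"
    then obtain x C where "x \<in> C" "C \<in> \<C>" "T = connected_component_set (\<Union>\<C>) x"
      by (auto simp: components_iff)
    then show "T \<in> \<C>" using comp by simp
  next
    fix C assume C: "C \<in> \<C>"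
    then obtain x where "x \<in> C" using assms by blast
    then show "C \<in> components (\<Union>\<C>)"
      using comp[OF C] C by (auto simp: components_iff intro!: exI[of _ x])
  qed
qed

definition real_vec :: "int ^ 'n \<Rightarrow> real ^ 'n" where
  "real_vec a = (\<chi> j. of_int (a $ j))"

lemma inner_real_vec: "real_vec a \<bullet> x = (\<Sum>j\<in>UNIV. of_int (a $ j) * x $ j)"
  by (simp add: real_vec_def inner_vec_def)

lemma abs_torus_in_toric_hyperplane:
  "abs_torus x \<in> toric_hyperplane a (abs_circle b) \<longleftrightarrow> real_vec a \<bullet> x - b \<in> \<int>"
  by (simp add: toric_hyperplane_def torus_dot.abs_eq circle.abs_eq_iff int_equiv_def inner_real_vec)

lemma inner_real_vec_int:
  assumes "\<forall>i. k $ i \<in> \<int>"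
  shows "real_vec a \<bullet> k \<in> \<int>"
  unfolding inner_real_vec using assms by (intro Ints_sum Ints_mult) auto

lemma simple_hyperplane_lift:
  assumes "is_simple_hyperplane_with_normal H a"
  obtains b where "\<And>x. abs_torus x \<in> H \<longleftrightarrow> real_vec a \<bullet> x - b \<in> \<int>"
proof -
  obtain c where "H = toric_hyperplane a c"
    using assms by (auto simp: is_simple_hyperplane_with_normal_def is_hyperplane_with_normal_def)
  moreover obtain b where "c = abs_circle b"
    by (metis circle.abs_eq_iff Quotient3_abs_rep Quotient3_circle)
  ultimately show thesis using that abs_torus_in_toric_hyperplane by blast
qed

section \<open>General position in the universal cover\<close>

text \<open>Through this bound, an affine subspace contained in an intersection of hyperplanes gives information about
the dimension in the definition of general position.\<close>

lemma aff_dim_le_toric_dim: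
  fixes X :: "'n::finite torus set"
  assumes "connected L" "L \<noteq> {}" "L \<subseteq> abs_torus -` X"
  shows "aff_dim L \<le> toric_dim X"
proof -
  obtain C where C: "C \<in> components (abs_torus -` X)" "L \<subseteq> C"
    using exists_component_superset[of L "abs_torus -` X"] assms by auto
  have "- 1 \<le> aff_dim D \<and> aff_dim D \<le> int CARD('n)" for D :: "(real ^ 'n) set"
    using aff_dim_geq[of D] aff_dim_le_DIM[of D] by simp
  then have "aff_dim ` components (abs_torus -` X) \<subseteq> {- 1 .. int CARD('n)}" by auto
  then have "finite (aff_dim ` components (abs_torus -` X))" by (rule finite_subset) simp
  then have "aff_dim C \<le> toric_dim X" using C by (simp add: toric_dim_def)
  then show ?thesis using aff_dim_subset[OF C(2)] by simp
qed

lemma aff_dim_inner_eq: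
  fixes A :: "'a::euclidean_space set"
  shows "aff_dim {x. \<forall>a\<in>A. a \<bullet> x = a \<bullet> v} = int DIM('a) - int (dim A)"
proof -
  let ?W = "{y. \<forall>a\<in>A. a \<bullet> y = 0}"
  have W: "{y \<in> UNIV. \<forall>x\<in>span A. orthogonal x y} = ?W"
  proof (intro equalityI subsetI)
    fix y assume "y \<in> ?W"
    then have "orthogonal y x" if "x \<in> A" for x
      using that by (simp add: orthogonal_def inner_commute)
    then have "orthogonal y x" if "x \<in> span A" for x
      using that by (rule orthogonal_to_span[rotated])
    then show "y \<in> {y \<in> UNIV. \<forall>x\<in>span A. orthogonal x y}" by (simp add: orthogonal_commute)
  next
    fix y assume "y \<in> {y \<in> UNIV. \<forall>x\<in>span A. orthogonal x y}"
    then show "y \<in> ?W"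
      using span_base[of _ A] by (simp add: orthogonal_def)
  qed
  have "{x. \<forall>a\<in>A. a \<bullet> x = a \<bullet> v} = (+) v ` ?W"
  proof (intro equalityI subsetI)
    fix x assume "x \<in> {x. \<forall>a\<in>A. a \<bullet> x = a \<bullet> v}"
    then show "x \<in> (+) v ` ?W"
      by (intro image_eqI[of _ _ "x - v"]) (auto simp: inner_diff_right)
  qed (auto simp: inner_add_right)
  moreover have "subspace ?W"
    by (auto simp: subspace_def inner_add_right)
  ultimately have "aff_dim {x. \<forall>a\<in>A. a \<bullet> x = a \<bullet> v} = int (dim ?W)"
    by (simp only: aff_dim_translation_eq aff_dim_subspace)
  moreover have "dim ?W + dim A = DIM('a)"
    using dim_subspace_orthogonal_to_vectors[of "span A" UNIV] unfolding W by simp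
  ultimately show ?thesis by linarith
qed

text \<open>If \<open>r\<close> hyperplanes meet in a point, then general position excludes \<open>r > n\<close>, and the affine
subspace through that point that they contain, of dimension \<open>n\<close> minus the rank of their normals,
has dimension at most \<open>n - r\<close>. So the rank is at least \<open>r\<close>.\<close>

lemma general_position_tight:
  fixes H :: "'i \<Rightarrow> 'n::finite torus set" and a :: "'i \<Rightarrow> int ^ 'n"
  assumes gp: "general_position (H ` I)" and I: "finite I" "inj_on H I"
    and H: "\<And>i x. i \<in> I \<Longrightarrow> abs_torus x \<in> H i \<longleftrightarrow> real_vec (a i) \<bullet> x - \<beta> i \<in> \<int>"
  defines "J v \<equiv> {i\<in>I. real_vec (a i) \<bullet> v - \<beta> i \<in> \<int>}"
  shows "independent ((\<lambda>i. real_vec (a i)) ` J v)" and "inj_on (\<lambda>i. real_vec (a i)) (J v)"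
proof -
  define \<alpha> where "\<alpha> i = real_vec (a i)" for i
  have J: "J v \<subseteq> I" "finite (J v)" using I by (auto simp: J_def)
  have le: "card (J v) \<le> dim (\<alpha> ` J v)"
  proof (cases "J v = {}")
    case False
    let ?L = "{x. \<forall>a\<in>\<alpha> ` J v. a \<bullet> x = a \<bullet> v}"
    have card: "card (H ` J v) = card (J v)"
    by (rule card_image[OF inj_on_subset[OF I(2) J(1)]])
    have *: "card (H ` J v) \<le> CARD('n) \<longrightarrow> toric_dim (\<Inter>(H ` J v)) \<le> int CARD('n) - int (card (H ` J v))"
      "card (H ` J v) > CARD('n) \<longrightarrow> \<Inter>(H ` J v) = {}"
      using gp[unfolded general_position_def, rule_format, of "H ` J v"] False image_mono[OF J(1), of H]
      by simp_all
    have "abs_torus v \<in> \<Inter>(H ` J v)"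
      using H J(1) by (auto simp: J_def)
    then have dim: "toric_dim (\<Inter>(H ` J v)) \<le> int CARD('n) - int (card (J v))"
      using * card by (metis empty_iff not_le)
    have "convex ?L"
      by (intro convexI) (auto simp: inner_add_right simp flip: distrib_right)
    then have "aff_dim ?L \<le> toric_dim (\<Inter>(H ` J v))"
      using H J(1) by (intro aff_dim_le_toric_dim convex_connected) (auto simp: J_def \<alpha>_def)
    then show ?thesis using dim unfolding aff_dim_inner_eq by simp
  qed simp
  have "dim (\<alpha> ` J v) \<le> card (\<alpha> ` J v)" "card (\<alpha> ` J v) \<le> card (J v)"
    using J(2) by (auto intro: dim_le_card' card_image_le)
  then have eq: "card (\<alpha> ` J v) = card (J v)" "card (\<alpha> ` J v) = dim (\<alpha> ` J v)" using le by auto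
  show "inj_on (\<lambda>i. real_vec (a i)) (J v)"
    using eq(1) J(2) by (simp add: eq_card_imp_inj_on \<alpha>_def)
  show "independent ((\<lambda>i. real_vec (a i)) ` J v)"
    using card_eq_dim[of "\<alpha> ` J v" "\<alpha> ` J v"] eq(2) J(2) by (simp add: span_superset \<alpha>_def)
qed

text \<open>Finitely many proper subspaces do not cover the space, since each is a null set.\<close>

lemma exists_generic_functional:
  fixes \<alpha> :: "'i \<Rightarrow> 'a::euclidean_space"
  assumes "finite I"
  obtains w where "\<And>J. J \<subseteq> I \<Longrightarrow> dim (\<alpha> ` J) < DIM('a) \<Longrightarrow> w \<notin> span (\<alpha> ` J)"
proof -
  define \<J> where "\<J> = {J. J \<subseteq> I \<and> dim (\<alpha> ` J) < DIM('a)}"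
  have "finite \<J>" using assms by (simp add: \<J>_def)
  then have "negligible (\<Union>J\<in>\<J>. span (\<alpha> ` J))"
    by (intro negligible_Union) (auto simp: \<J>_def intro!: negligible_lowdim)
  then have "(\<Union>J\<in>\<J>. span (\<alpha> ` J)) \<noteq> UNIV" using non_negligible_UNIV by metis
  then obtain w where "w \<notin> (\<Union>J\<in>\<J>. span (\<alpha> ` J))" by blast
  then show thesis using that by (auto simp: \<J>_def)
qed

section \<open>Regions correspond to vertices\<close>

locale toric_grid = hyperplane_grid I "\<lambda>i. real_vec (a i)" \<beta> w
  for I :: "'i set" and a :: "'i \<Rightarrow> int ^ 'n::finite" and \<beta> w +
  fixes H :: "'i \<Rightarrow> 'n torus set"
  assumes mem_H: "\<And>i x. i \<in> I \<Longrightarrow> abs_torus x \<in> H i \<longleftrightarrow> real_vec (a i) \<bullet> x - \<beta> i \<in> \<int>"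
begin

lemma tight_eq: "tight x = {i\<in>I. abs_torus x \<in> H i}"
  using mem_H by (auto simp: tight_def level_def)

definition region :: "('i \<Rightarrow> int) \<Rightarrow> 'n torus set" where
  "region f = abs_torus ` cell f"

definition vertices :: "'n torus set" where
  "vertices = {p. card {i\<in>I. p \<in> H i} = CARD('n)}"

lemma abs_torus_in_vertices: "abs_torus x \<in> vertices \<longleftrightarrow> card (tight x) = CARD('n)"
  by (simp add: vertices_def tight_eq)

lemma cell_translate_lattice:
  assumes "abs_torus y = abs_torus x"
  shows "\<exists>g. cell g = (+) (y - x) ` cell f \<and> region g = region f \<and>
    (\<forall>v. lowest f v \<longrightarrow> lowest g (v + (y - x)))"
proof -
  have k: "\<forall>i. (y - x) $ i \<in> \<int>" using assms by (simp add: abs_torus_eq_iff)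
  obtain g where g: "cell g = (+) (y - x) ` cell f" "\<forall>v. lowest f v \<longrightarrow> lowest g (v + (y - x))"
    using cell_translate[of "y - x" f] inner_real_vec_int[OF k] by auto
  have "abs_torus (y - x + z) = abs_torus z" for z
    using k by (simp add: abs_torus_eq_iff)
  then have "region g = region f"
    unfolding region_def g(1) image_image by simp
  then show ?thesis using g by blast
qed

lemma region_eq_if_meet:
  assumes "region f \<inter> region g \<noteq> {}"
  shows "region f = region g"
proof -
  obtain p where p: "p \<in> region f" "p \<in> region g" using assms by blast
  obtain x where x: "x \<in> cell f" "p = abs_torus x" using p(1) by (auto simp: region_def)
  obtain y where y: "y \<in> cell g" "p = abs_torus y" using p(2) by (auto simp: region_def)
  have xy: "abs_torus y = abs_torus x" using x y by simp
  obtain h where h: "cell h = (+) (y - x) ` cell f" "region h = region f"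
    using cell_translate_lattice[OF xy, of f] by auto
  have "y \<in> cell h" unfolding h(1) using x(1) by (intro image_eqI[of _ _ x]) auto
  then have "cell h = cell g" using y(1) by (rule cell_eq_if_meet)
  then show ?thesis using h(2) by (simp add: region_def)
qed

lemma complement_eq_Union_regions: "UNIV - \<Union>(H ` I) = \<Union>{region f | f. cell f \<noteq> {}}"
proof (intro equalityI subsetI)
  fix p assume p: "p \<in> UNIV - \<Union>(H ` I)"
  obtain x where x: "p = abs_torus x" by (rule abs_torus_surj)
  have "x \<in> cell (\<lambda>i. \<lfloor>level i x\<rfloor>)"
    unfolding cell_def
  proof (intro CollectI ballI conjI)
    fix i assume "i \<in> I"
    then have "level i x \<notin> \<int>" using p mem_H by (auto simp: x level_def)
    then have "level i x \<noteq> of_int \<lfloor>level i x\<rfloor>" by (metis Ints_of_int)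
    then show "of_int \<lfloor>level i x\<rfloor> < level i x" by linarith
  qed linarith
  then show "p \<in> \<Union>{region f | f. cell f \<noteq> {}}" by (auto simp: region_def x)
next
  fix p assume "p \<in> \<Union>{region f | f. cell f \<noteq> {}}"
  then obtain f x where x: "x \<in> cell f" "p = abs_torus x" by (auto simp: region_def)
  have "level i x \<notin> \<int>" if "i \<in> I" for i
  proof
    assume "level i x \<in> \<int>"
    then obtain k where "level i x = of_int k" by (rule Ints_cases)
    then show False using x(1) that unfolding cell_def by force
  qed
  then show "p \<in> UNIV - \<Union>(H ` I)" using mem_H by (auto simp: x level_def)
qed

lemma components_complement: "components (UNIV - \<Union>(H ` I)) = {region f | f. cell f \<noteq> {}}"
  unfolding complement_eq_Union_regions
proof (rule components_disjoint_open_connected)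
  fix C assume "C \<in> {region f | f. cell f \<noteq> {}}"
  then obtain f where "C = region f" "cell f \<noteq> {}" by blast
  then show "open C \<and> connected C \<and> C \<noteq> {}"
    unfolding region_def
    by (auto intro!: open_abs_torus_image open_cell connected_continuous_image
        continuous_on_abs_torus convex_connected convex_cell)
qed (use region_eq_if_meet in blast)

text \<open>Upstairs, the lowest vertex of a cell is unique and a vertex is the lowest one of a unique cell.
Both directions of this correspondence commute with lattice translations, so it descends to the
torus.\<close>

lemma regions_vertices_bij:
  "\<exists>g. bij_betw g vertices (components (UNIV - \<Union>(H ` I)))"
proof -
  have ex: "\<exists>f v. p = abs_torus v \<and> cell f \<noteq> {} \<and> lowest f v" if "p \<in> vertices" for p
  proof -
    obtain v where v: "p = abs_torus v" by (rule abs_torus_surj)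
    with that have "card (tight v) = DIM(real ^ 'n)" by (simp add: abs_torus_in_vertices)
    then show ?thesis using v vertex_is_lowest by metis
  qed
  then obtain f v where fv: "\<And>p. p \<in> vertices \<Longrightarrow> p = abs_torus (v p) \<and> cell (f p) \<noteq> {} \<and> lowest (f p) (v p)"
    by metis
  have eq: "region f1 = region f2 \<longleftrightarrow> abs_torus v1 = abs_torus v2"
    if low: "lowest f1 v1" "lowest f2 v2" and ne: "cell f1 \<noteq> {}" for f1 f2 v1 v2
  proof
    assume "abs_torus v1 = abs_torus v2"
    then have "abs_torus v2 = abs_torus v1" by simp
    then obtain h where h: "cell h = (+) (v2 - v1) ` cell f1" "region h = region f1"
      "\<forall>v. lowest f1 v \<longrightarrow> lowest h (v + (v2 - v1))"
      using cell_translate_lattice[of v2 v1 f1] by auto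
    then have "lowest h v2" using h(3)[rule_format, OF low(1)] by simp
    then have "cell h = cell f2" using low(2) by (rule lowest_determines_cell)
    then show "region f1 = region f2" using h(2) by (simp add: region_def)
  next
    assume eq: "region f1 = region f2"
    obtain x where x: "x \<in> cell f1" using ne by blast
    then have "abs_torus x \<in> region f2" unfolding eq[symmetric] by (simp add: region_def)
    then obtain y where y: "y \<in> cell f2" "abs_torus y = abs_torus x" by (auto simp: region_def)
    obtain h where h: "cell h = (+) (y - x) ` cell f1" "region h = region f1"
      "\<forall>v. lowest f1 v \<longrightarrow> lowest h (v + (y - x))"
      using cell_translate_lattice[OF y(2), of f1] by auto
    have "y \<in> cell h" unfolding h(1) using x by (intro image_eqI[of _ _ x]) auto
    then have "lowest f2 (v1 + (y - x))" 
      using lowest_eq_if_meet[OF _ y(1)] h(3)[rule_format, OF low(1)] by blast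
    then have "v2 = v1 + (y - x)" using low(2) by (rule lowest_unique)
    then have "abs_torus v2 = abs_torus v1" using y(2) by (simp add: abs_torus_eq_iff)
    then show "abs_torus v1 = abs_torus v2" by simp
  qed
  have "bij_betw (\<lambda>p. region (f p)) vertices (components (UNIV - \<Union>(H ` I)))"
    unfolding bij_betw_def components_complement
  proof (intro conjI inj_onI equalityI subsetI)
    fix p q assume pq: "p \<in> vertices" "q \<in> vertices" "region (f p) = region (f q)"
    then show "p = q" using fv[OF pq(1)] fv[OF pq(2)] eq[of "f p" "v p" "f q" "v q"] by simp
  next
    fix C assume "C \<in> {region f | f. cell f \<noteq> {}}"
    then obtain g where g: "C = region g" "cell g \<noteq> {}" by blast
    obtain u where u: "lowest g u" using lowest_exists[OF g(2)] by blast
    have vert: "abs_torus u \<in> vertices"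
      using lowest_imp_vertex[OF u] by (simp add: abs_torus_in_vertices)
    have "C = region (f (abs_torus u))"
      using fv[OF vert] eq[of g u "f (abs_torus u)" "v (abs_torus u)"] u g by simp
    with vert show "C \<in> (\<lambda>p. region (f p)) ` vertices" by blast
  qed (use fv in auto)
  then show ?thesis by blast
qed

lemma card_regions_eq_card_vertices: "card (components (UNIV - \<Union>(H ` I))) = card vertices"
  using regions_vertices_bij bij_betw_same_card by metis

lemma vertices_eq_Union: "vertices = (\<Union>S\<in>{S. S \<subseteq> I \<and> card S = CARD('n)}. \<Inter>(H ` S))"
proof (intro equalityI subsetI)
  fix p assume "p \<in> vertices"
  then show "p \<in> (\<Union>S\<in>{S. S \<subseteq> I \<and> card S = CARD('n)}. \<Inter>(H ` S))"
    by (intro UN_I[of "{i\<in>I. p \<in> H i}"]) (auto simp: vertices_def)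
next
  fix p assume "p \<in> (\<Union>S\<in>{S. S \<subseteq> I \<and> card S = CARD('n)}. \<Inter>(H ` S))"
  then obtain S where S: "S \<subseteq> I" "card S = CARD('n)" "p \<in> \<Inter>(H ` S)" by blast
  obtain x where x: "p = abs_torus x" by (rule abs_torus_surj)
  have "S \<subseteq> tight x" using S x by (auto simp: tight_eq)
  then show "p \<in> vertices"
    using card_mono[OF finite_tight, of S x] card_tight_le[of x] S(2)
    by (simp add: x abs_torus_in_vertices)
qed

text \<open>No point lies on more than \<open>n\<close> hyperplanes. Hence distinct \<open>n\<close>-subsets have disjoint
intersections, and the vertices can be counted one subset at a time.\<close>

lemma tight_eq_if_mem:
  assumes "S \<subseteq> I" "card S = CARD('n)" "abs_torus x \<in> \<Inter>(H ` S)"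
  shows "S = tight x"
proof (rule card_subset_eq[OF finite_tight])
  show *: "S \<subseteq> tight x" using assms by (auto simp: tight_eq)
  show "card S = card (tight x)"
    using card_mono[OF finite_tight *] card_tight_le[of x] assms(2) by simp
qed

lemma card_vertices:
  assumes fin: "\<And>S. S \<subseteq> I \<Longrightarrow> card S = CARD('n) \<Longrightarrow> finite (\<Inter>(H ` S))"
  shows "card vertices = (\<Sum>S | S \<subseteq> I \<and> card S = CARD('n). card (\<Inter>(H ` S)))"
  unfolding vertices_eq_Union
proof (rule card_UN_disjoint)
  show "\<forall>S\<in>{S. S \<subseteq> I \<and> card S = CARD('n)}. \<forall>T\<in>{S. S \<subseteq> I \<and> card S = CARD('n)}.
      S \<noteq> T \<longrightarrow> \<Inter>(H ` S) \<inter> \<Inter>(H ` T) = {}"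
  proof (intro ballI impI)
    fix S T assume ST: "S \<in> {S. S \<subseteq> I \<and> card S = CARD('n)}" "T \<in> {S. S \<subseteq> I \<and> card S = CARD('n)}" "S \<noteq> T"
    have False if p: "p \<in> \<Inter>(H ` S)" "p \<in> \<Inter>(H ` T)" for p
    proof -
      obtain x where "p = abs_torus x" by (rule abs_torus_surj)
      then have "S = tight x" "T = tight x" using ST p tight_eq_if_mem by auto
      then show False using ST by simp
    qed
    then show "\<Inter>(H ` S) \<inter> \<Inter>(H ` T) = {}" by blast
  qed
qed (use fin finite_I in auto)

end

section \<open>Counting the solutions of a linear congruence\<close>

definition frac_vec :: "real ^ 'n \<Rightarrow> real ^ 'n" where
  "frac_vec x = (\<chi> i. frac (x $ i))"

text \<open>A fundamental domain for the integer lattice, with \<open>frac_vec\<close> as the retraction onto it.\<close>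

definition half_open_cube :: "(real ^ 'n) set" where
  "half_open_cube = {x. \<forall>i. 0 \<le> x $ i \<and> x $ i < 1}"

lemma frac_vec_in_cube: "frac_vec x \<in> half_open_cube"
  by (simp add: frac_vec_def half_open_cube_def frac_lt_1)

lemma frac_vec_int: "(frac_vec x - x) $ i \<in> \<int>"
  by (simp add: frac_vec_def frac_def)

lemma frac_vec_unique:
  assumes "y \<in> half_open_cube" "\<forall>i. (x - y) $ i \<in> \<int>"
  shows "frac_vec x = y"
  using assms by (auto simp: vec_eq_iff frac_vec_def half_open_cube_def frac_unique_iff)

definition cube_solutions :: "real ^ 'n ^ 'n \<Rightarrow> real ^ 'n \<Rightarrow> (real ^ 'n) set" where
  "cube_solutions M b = {x \<in> half_open_cube. \<forall>r. (M *v x - b) $ r \<in> \<int>}"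

lemma int_matrix_vector_mult:
  assumes "\<And>i j. M $ i $ j \<in> \<int>" "\<And>j. k $ j \<in> (\<int> :: real set)"
  shows "(M *v k) $ r \<in> \<int>"
  unfolding matrix_vector_mult_def using assms by (auto intro!: Ints_sum Ints_mult)

lemma frac_vec_solution:
  assumes "\<And>i j. M $ i $ j \<in> \<int>" "\<forall>r. (M *v x - b) $ r \<in> (\<int> :: real set)"
  shows "frac_vec x \<in> cube_solutions M b"
proof -
  have "M *v frac_vec x - b = M *v (frac_vec x - x) + (M *v x - b)"
    by (simp add: matrix_vector_mult_diff_distrib)
  moreover have "(M *v (frac_vec x - x)) $ r \<in> \<int>" for r
    using assms(1) frac_vec_int by (rule int_matrix_vector_mult)
  ultimately have "(M *v frac_vec x - b) $ r \<in> \<int>" for r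
    using assms(2) by (metis Ints_add vector_add_component)
  then show ?thesis
    using frac_vec_in_cube[of x] by (auto simp: cube_solutions_def)
qed

text \<open>Solution sets are fibres of an endomorphism of the torus, which is surjective as the determinant
is nonzero; a translation of the torus carries one fibre to another.\<close>

lemma card_cube_solutions_eq:
  fixes M :: "real ^ 'n ^ 'n"
  assumes int: "\<And>i j. M $ i $ j \<in> \<int>" and det: "det M \<noteq> 0"
  shows "card (cube_solutions M b) = card (cube_solutions M b')"
proof -
  have "surj ((*v) M)"
    using det by (metis invertible_det_nz invertible_right_inverse matrix_right_invertible_surjective)
  then obtain t where t: "M *v t = b' - b" by (metis surjD)
  have shift: "frac_vec (x + s) \<in> cube_solutions M d" "frac_vec (frac_vec (x + s) - s) = x"
    if "x \<in> cube_solutions M c" "M *v s = d - c" for x s c d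
  proof -
    show "frac_vec (x + s) \<in> cube_solutions M d"
      using that
      by (intro frac_vec_solution int) (auto simp: cube_solutions_def matrix_vector_right_distrib)
    have "(frac_vec (x + s) - s - x) $ i \<in> \<int>" for i
      using frac_vec_int[of "x + s" i] by (simp add: algebra_simps)
    then show "frac_vec (frac_vec (x + s) - s) = x"
      using that by (intro frac_vec_unique) (auto simp: cube_solutions_def)
  qed
  have t': "M *v (- t) = b - b'"
    using linear_neg[OF matrix_vector_mul_linear, of M t] t by simp
  have "bij_betw (\<lambda>x. frac_vec (x + t)) (cube_solutions M b) (cube_solutions M b')"
    by (rule bij_betw_byWitness[where f' = "\<lambda>x. frac_vec (x - t)"])
       (use shift[OF _ t] shift[OF _ t'] in auto)
  then show ?thesis by (rule bij_betw_same_card)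
qed

lemma half_open_cube_measure:
  "(half_open_cube :: (real ^ 'n) set) \<in> lmeasurable"
  "measure lebesgue (half_open_cube :: (real ^ 'n) set) = 1"
proof -
  let ?C = "half_open_cube :: (real ^ 'n) set" and ?u = "(\<chi> i. 1) :: real ^ 'n"
  have "?C = (\<Inter>i. {x. 0 \<le> x $ i} \<inter> {x. x $ i < 1})"
    by (auto simp: half_open_cube_def)
  also have "\<dots> \<in> sets borel"
    by (intro sets.finite_INT sets.Int borel_closed borel_open closed_Collect_le open_Collect_less
        continuous_intros) auto
  finally have "?C \<in> sets lebesgue" by (rule sets_completionI_sets[of _ lborel, simplified])
  moreover have sub: "box 0 ?u \<subseteq> ?C" "?C \<subseteq> cbox 0 ?u"
    by (auto simp: half_open_cube_def mem_box_cart less_imp_le)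
  ultimately show C: "?C \<in> lmeasurable"
    by (intro bounded_set_imp_lmeasurable) (auto intro: bounded_subset[OF bounded_cbox])
  have u: "?u \<bullet> b = 1" if "b \<in> Basis" for b
    using that by (auto simp: Basis_vec_def inner_axis)
  have "measure lebesgue (box 0 ?u) = 1" "measure lebesgue (cbox 0 ?u) = 1"
    using measure_lborel_box[of 0 ?u] measure_lborel_cbox[of 0 ?u] by (auto simp: u)
  moreover have "measure lebesgue (box 0 ?u) \<le> measure lebesgue ?C"
    "measure lebesgue ?C \<le> measure lebesgue (cbox 0 ?u)"
    using measure_mono_fmeasurable[OF sub(1), of lebesgue] measure_mono_fmeasurable[OF sub(2), of lebesgue] C
    by (auto simp del: measure_completion)
  ultimately show "measure lebesgue ?C = 1" by simp
qed

lemma finite_bounded_int_vectors: "finite {k :: real ^ 'n. \<forall>i. k $ i \<in> \<int> \<and> \<bar>k $ i\<bar> \<le> R}"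
proof -
  have "{k :: real ^ 'n. \<forall>i. k $ i \<in> \<int> \<and> \<bar>k $ i\<bar> \<le> R}
      \<subseteq> (\<lambda>g. \<chi> i. g i) ` (UNIV \<rightarrow>\<^sub>E {z \<in> \<int>. \<bar>z\<bar> \<le> R})"
  proof
    fix k :: "real ^ 'n" assume "k \<in> {k. \<forall>i. k $ i \<in> \<int> \<and> \<bar>k $ i\<bar> \<le> R}"
    then show "k \<in> (\<lambda>g. \<chi> i. g i) ` (UNIV \<rightarrow>\<^sub>E {z \<in> \<int>. \<bar>z\<bar> \<le> R})"
      by (intro image_eqI[of _ _ "\<lambda>i. k $ i"]) auto
  qed
  then show ?thesis
    by (rule finite_subset) (intro finite_imageI finite_PiE finite_abs_int_segment, simp)
qed

text \<open>Let \<open>P\<close> be the image of the unit cube under \<open>M\<close>. The solutions for \<open>b\<close> correspond to the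
lattice vectors \<open>k\<close> with \<open>b + k \<in> P\<close>. Their number is independent of \<open>b\<close>, so it equals its
integral over all \<open>b\<close> in the cube. This integral is the volume of \<open>P\<close>, which the lattice
translates of the cube cut into pieces.\<close>

lemma card_cube_solutions_wellorder:
  fixes M :: "real ^ 'n::{finite,wellorder} ^ 'n::_"
  assumes int: "\<And>i j. M $ i $ j \<in> \<int>" and det: "det M \<noteq> 0"
  shows "finite (cube_solutions M b)" "real (card (cube_solutions M b)) = \<bar>det M\<bar>"
proof -
  let ?C = "half_open_cube :: (real ^ 'n::_) set"
  define P where "P = (*v) M ` ?C"
  have inj: "inj ((*v) M)"
    using det by (metis invertible_det_nz invertible_left_inverse matrix_left_invertible_injective)
  have lin: "linear ((*v) M)" by simp
  have P: "P \<in> lmeasurable" "measure lebesgue P = \<bar>det M\<bar>"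
    using measurable_linear_image[OF lin half_open_cube_measure(1)]
      measure_linear_image[OF lin half_open_cube_measure(1)] half_open_cube_measure(2)
    by (auto simp: P_def)
  have C_bounded: "bounded ?C"
    by (rule bounded_subset[OF bounded_cbox[of 0 "\<chi> i. 1"]])
       (auto simp: half_open_cube_def mem_box_cart less_imp_le)
  then have "bounded P"
    unfolding P_def using lin by (intro bounded_linear_image linear_linear[THEN iffD1]) auto
  then obtain R where R: "\<And>y. y \<in> P \<Longrightarrow> norm y \<le> R" by (auto simp: bounded_iff)
  have sol_img: "(\<lambda>x. M *v x - b) ` cube_solutions M b = {k. (\<forall>i. k $ i \<in> \<int>) \<and> b + k \<in> P}" for b
  proof (intro equalityI subsetI)
    fix k assume "k \<in> {k. (\<forall>i. k $ i \<in> \<int>) \<and> b + k \<in> P}"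
    then obtain x where x: "x \<in> ?C" "b + k = M *v x" "\<forall>i. k $ i \<in> \<int>" by (auto simp: P_def)
    then have "k = M *v x - b" by (metis add_diff_cancel_left')
    then show "k \<in> (\<lambda>x. M *v x - b) ` cube_solutions M b"
      using x by (intro image_eqI[of _ _ x]) (auto simp: cube_solutions_def)
  qed (auto simp: cube_solutions_def P_def)
  have inj_sol: "inj_on (\<lambda>x. M *v x - b) S" for b S
    using inj by (auto simp: inj_on_def)
  define K :: "real ^ 'n::_ \<Rightarrow> (real ^ 'n::_) set"
    where "K b = {k. (\<forall>i. k $ i \<in> \<int> \<and> \<bar>k $ i\<bar> \<le> R + norm b)}" for b
  have K_fin: "finite (K b)" for b unfolding K_def by (rule finite_bounded_int_vectors)
  have K_sub: "k \<in> K b" if "\<forall>i. k $ i \<in> \<int>" "b + k \<in> P" for k b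
  proof -
    have "norm k \<le> norm (b + k) + norm b"
      by (metis add.commute add_diff_cancel_right' norm_triangle_ineq4)
    then have "norm k \<le> R + norm b" using R[OF that(2)] by simp
    then show ?thesis using that component_le_norm_cart[of k] by (auto simp: K_def intro: order_trans)
  qed
  have "finite ((\<lambda>x. M *v x - b) ` cube_solutions M b)"
    unfolding sol_img by (rule finite_subset[OF _ K_fin[of b]]) (use K_sub in auto)
  then show "finite (cube_solutions M b)" using inj_sol by (rule finite_imageD)
  obtain Q where Q: "\<And>y. y \<in> ?C \<Longrightarrow> norm y \<le> Q" using C_bounded by (auto simp: bounded_iff)
  \<comment> \<open>Every lattice vector that carries some point of the cube into \<open>P\<close> is in the finite set \<open>L\<close>;
    \<open>T k\<close> consists of the points of the cube that \<open>k\<close> carries into \<open>P\<close>.\<close>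
  define L where "L = {k :: real ^ 'n::_. \<forall>i. k $ i \<in> \<int> \<and> \<bar>k $ i\<bar> \<le> R + Q}"
  have L_fin: "finite L" unfolding L_def by (rule finite_bounded_int_vectors)
  have L_sub: "k \<in> L" if "\<forall>i. k $ i \<in> \<int>" "b + k \<in> P" "b \<in> ?C" for k b
  proof -
    have "\<bar>k $ i\<bar> \<le> R + Q" for i
      using K_sub[OF that(1,2)] Q[OF that(3)] by (force simp: K_def intro: order_trans)
    then show ?thesis using that by (simp add: L_def)
  qed
  let ?N = "real (card (cube_solutions M b))"
  define T where "T k = ?C \<inter> (+) (- k) ` P" for k
  have T_meas: "T k \<in> lmeasurable" for k
    unfolding T_def using P(1) half_open_cube_measure(1)
    by (intro fmeasurable.Int measurable_translation)
  have count: "?N * indicator ?C x = (\<Sum>k\<in>L. indicator (T k) x)" for x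
  proof (cases "x \<in> ?C")
    case True
    have mem: "x \<in> T k \<longleftrightarrow> x + k \<in> P" for k
    proof -
      have "x \<in> (+) (- k) ` P \<longleftrightarrow> x + k \<in> P"
        by (metis (no_types, lifting) add.commute add_minus_cancel image_iff minus_add_cancel)
      then show ?thesis using True by (simp add: T_def)
    qed
    have "card (cube_solutions M b) = card (cube_solutions M x)"
      using int det by (rule card_cube_solutions_eq)
    also have "\<dots> = card {k. (\<forall>i. k $ i \<in> \<int>) \<and> x + k \<in> P}"
      using card_image[OF inj_sol[of x "cube_solutions M x"]] by (simp add: sol_img)
    also have "{k. (\<forall>i. k $ i \<in> \<int>) \<and> x + k \<in> P} = {k \<in> L. x \<in> T k}"
      using L_sub True by (auto simp: mem L_def)
    also have "real (card \<dots>) = (\<Sum>k\<in>L. indicator (T k) x)"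
      using L_fin by (simp add: indicator_def sum.If_cases Int_def)
    finally show ?thesis using True by simp
  next
    case False
    then show ?thesis by (simp add: T_def)
  qed
  have "?N = integral\<^sup>L lebesgue (\<lambda>x. ?N * indicator ?C x)"
    by (simp add: half_open_cube_measure)
  also have "\<dots> = (\<Sum>k\<in>L. integral\<^sup>L lebesgue (indicator (T k)))"
    unfolding count using T_meas unfolding fmeasurable_def
    by (intro Bochner_Integration.integral_sum integrable_real_indicator) blast+
  also have "\<dots> = (\<Sum>k\<in>L. measure lebesgue (T k))" by simp
  also have "\<dots> = (\<Sum>k\<in>L. measure lebesgue ((+) k ` T k))" by (simp add: measure_translation)
  also have "\<dots> = measure lebesgue (\<Union>k\<in>L. (+) k ` T k)"
  proof (rule measure_UNION'[symmetric, OF L_fin])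
    show "(+) k ` T k \<in> lmeasurable" for k using T_meas by (rule measurable_translation)
    show "pairwise (\<lambda>k l. disjnt ((+) k ` T k) ((+) l ` T l)) L"
    proof (intro pairwiseI)
      fix k l assume kl: "k \<in> L" "l \<in> L" "k \<noteq> l"
      have False if xy: "x \<in> ?C" "y \<in> ?C" "k + x = l + y" for x y
      proof -
        have "\<forall>i. (x - y) $ i \<in> \<int>" "\<forall>i. (y - y) $ i \<in> \<int>"
        proof -
          have "x - y = l - k" using xy(3) by (simp add: algebra_simps)
          then show "\<forall>i. (x - y) $ i \<in> \<int>" using kl by (simp add: L_def)
        qed simp
        then have "frac_vec x = y" using xy(2) by (intro frac_vec_unique)
        moreover have "frac_vec x = x" using xy(1) by (intro frac_vec_unique) auto
        ultimately show False using xy kl by simp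
      qed
      then show "disjnt ((+) k ` T k) ((+) l ` T l)" by (auto simp: disjnt_def T_def)
    qed
  qed
  also have "(\<Union>k\<in>L. (+) k ` T k) = P"
  proof (intro equalityI subsetI)
    fix y assume y: "y \<in> P"
    let ?b = "frac_vec y"
    have int: "\<forall>i. (y - ?b) $ i \<in> \<int>"
      using frac_vec_int[of y] by (metis Ints_minus minus_diff_eq vector_uminus_component)
    have "y - ?b \<in> L" using L_sub[OF int, of ?b] y frac_vec_in_cube[of y] by simp
    moreover have "?b \<in> T (y - ?b)"
      using y frac_vec_in_cube[of y] by (auto simp: T_def intro!: image_eqI[of _ _ y])
    ultimately show "y \<in> (\<Union>k\<in>L. (+) k ` T k)"
      by (intro UN_I[of "y - ?b"] image_eqI[of _ _ ?b]) auto
  qed (auto simp: T_def)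
  finally show "?N = \<bar>det M\<bar>" using P(2) by simp
qed

text \<open>The volume formula for linear images speaks of well-ordered index types. A well-ordered type with
\<open>CARD('n)\<close> elements makes the count available for every finite index type: both the number of
solutions and the determinant are invariant under a renaming of the indices.\<close>

typedef ('n::finite) ordered_copy = "{..<CARD('n)}"
  by (rule exI[of _ 0]) simp

instantiation ordered_copy :: (finite) linorder
begin

definition less_eq_ordered_copy :: "'a ordered_copy \<Rightarrow> 'a ordered_copy \<Rightarrow> bool" where
  "x \<le> y \<longleftrightarrow> Rep_ordered_copy x \<le> Rep_ordered_copy y"

definition less_ordered_copy :: "'a ordered_copy \<Rightarrow> 'a ordered_copy \<Rightarrow> bool" where
  "x < y \<longleftrightarrow> Rep_ordered_copy x < Rep_ordered_copy y"

instance
  by standard (auto simp: less_eq_ordered_copy_def less_ordered_copy_def Rep_ordered_copy_inject)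

end

lemma bij_Rep_ordered_copy: "bij_betw (Rep_ordered_copy :: 'n::finite ordered_copy \<Rightarrow> nat) UNIV {..<CARD('n)}"
  unfolding bij_betw_def using type_definition.Rep_range[OF type_definition_ordered_copy]
  by (auto simp: inj_on_def Rep_ordered_copy_inject)

instance ordered_copy :: (finite) finite
proof
  show "finite (UNIV :: 'a ordered_copy set)"
    by (rule bij_betw_finite[OF bij_Rep_ordered_copy, THEN iffD2, OF finite_lessThan])
qed

instance ordered_copy :: (finite) wellorder
proof
  fix P :: "'a ordered_copy \<Rightarrow> bool" and x
  assume step: "\<And>x. (\<And>y. y < x \<Longrightarrow> P y) \<Longrightarrow> P x"
  show "P x"
  proof (induction x rule: measure_induct_rule[of Rep_ordered_copy])
    case (less x)
    show ?case by (rule step) (use less in \<open>simp add: less_ordered_copy_def\<close>)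
  qed
qed

lemma ordered_copy_bij: obtains g :: "'n::finite ordered_copy \<Rightarrow> 'n" where "bij g"
proof -
  obtain h :: "'n \<Rightarrow> nat" where h: "bij_betw h UNIV {..<CARD('n)}"
    using ex_bij_betw_finite_nat[of "UNIV :: 'n set"] by (auto simp: atLeast0LessThan)
  have "bij (inv_into UNIV h \<circ> (Rep_ordered_copy :: 'n ordered_copy \<Rightarrow> nat))"
    using bij_betw_trans[OF bij_Rep_ordered_copy bij_betw_inv_into[OF h]] .
  then show thesis by (rule that)
qed

lemma det_reindex:
  fixes A :: "'a::comm_ring_1 ^ 'n ^ 'n" and g :: "'m::finite \<Rightarrow> 'n::finite"
  assumes g: "bij g"
  shows "det (\<chi> i j. A $ g i $ g j) = det A"
proof -
  let ?F = "map_permutation UNIV g" and ?G = "map_permutation UNIV (inv g)"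
  have F: "?F p (g i) = g (p i)" for p i
    using g by (simp add: map_permutation_def restrict_id_def bij_is_inj bij_is_surj)
  have ginv: "bij (inv g)" using g by (rule bij_imp_bij_inv)
  have "bij_betw ?F {p. p permutes UNIV} {p. p permutes UNIV}"
  proof (rule bij_betw_byWitness[where f' = ?G])
    show "\<forall>p\<in>{p. p permutes UNIV}. ?G (?F p) = p"
      using g by (auto intro!: map_permutation_compose_inv simp: bij_is_inj)
    show "\<forall>p\<in>{p. p permutes UNIV}. ?F (?G p) = p"
      using g ginv by (auto intro!: map_permutation_compose_inv simp: bij_is_surj surj_f_inv_f)
  qed (use g ginv in \<open>auto intro: map_permutation_permutes\<close>)
  then have "det A = (\<Sum>p\<in>{p. p permutes (UNIV :: 'm set)}.
      of_int (sign (?F p)) * (\<Prod>i\<in>UNIV. A $ i $ ?F p i))"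
    unfolding det_def by (rule sum.reindex_bij_betw[symmetric])
  also have "\<dots> = (\<Sum>p\<in>{p. p permutes UNIV}. of_int (sign p) * (\<Prod>i\<in>UNIV. A $ g i $ g (p i)))"
  proof (rule sum.cong[OF refl])
    fix p :: "'m \<Rightarrow> 'm" assume p: "p \<in> {p. p permutes UNIV}"
    have "sign (?F p) = sign p"
      using p g by (intro sign_map_permutation) (auto simp: bij_is_inj)
    moreover have "(\<Prod>i\<in>UNIV. A $ i $ ?F p i) = (\<Prod>i\<in>UNIV. A $ g i $ g (p i))"
      using prod.reindex_bij_betw[OF g, of "\<lambda>i. A $ i $ ?F p i"] by (simp add: F)
    ultimately show "of_int (sign (?F p)) * (\<Prod>i\<in>UNIV. A $ i $ ?F p i) =
        of_int (sign p) * (\<Prod>i\<in>UNIV. A $ g i $ g (p i))" by simp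
  qed
  finally show ?thesis by (simp add: det_def)
qed

lemma card_cube_solutions:
  fixes M :: "real ^ 'n ^ 'n"
  assumes int: "\<And>i j. M $ i $ j \<in> \<int>" and det: "det M \<noteq> 0"
  shows "finite (cube_solutions M b)" "real (card (cube_solutions M b)) = \<bar>det M\<bar>"
proof -
  obtain g :: "'n ordered_copy \<Rightarrow> 'n" where g: "bij g" by (rule ordered_copy_bij)
  let ?\<phi> = "\<lambda>x :: real ^ 'n. \<chi> i. x $ g i"
  let ?M = "\<chi> i j. M $ g i $ g j"
  have mult: "(?M *v ?\<phi> x) $ i = (M *v x) $ g i" for x i
    using sum.reindex_bij_betw[OF g, of "\<lambda>j. M $ g i $ j * x $ j"]
    by (simp add: matrix_vector_mult_def)
  have all: "(\<forall>i. Q (g i)) \<longleftrightarrow> (\<forall>i. Q i)" for Q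
    using g by (metis bij_pointE)
  have mem: "?\<phi> x \<in> cube_solutions ?M (?\<phi> b) \<longleftrightarrow> x \<in> cube_solutions M b" for x
    using all[of "\<lambda>i. 0 \<le> x $ i \<and> x $ i < 1"] all[of "\<lambda>i. (M *v x - b) $ i \<in> \<int>"]
    by (simp add: cube_solutions_def half_open_cube_def mult)
  have inv: "?\<phi> (\<chi> i. y $ inv g i) = y" for y
    using g by (simp add: vec_eq_iff bij_is_inj)
  have bij: "bij_betw ?\<phi> (cube_solutions M b) (cube_solutions ?M (?\<phi> b))"
    unfolding bij_betw_def
  proof (intro conjI equalityI subsetI)
    show "inj_on ?\<phi> (cube_solutions M b)"
    proof (rule inj_onI)
      fix x y :: "real ^ 'n" assume "?\<phi> x = ?\<phi> y"
      then show "x = y" using all[of "\<lambda>i. x $ i = y $ i"] by (simp add: vec_eq_iff)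
    qed
    fix y assume "y \<in> cube_solutions ?M (?\<phi> b)"
    then have "(\<chi> i. y $ inv g i) \<in> cube_solutions M b" using mem[of "\<chi> i. y $ inv g i"] inv by simp
    then show "y \<in> ?\<phi> ` cube_solutions M b" 
      by (rule image_eqI[rotated]) (rule inv[symmetric])
  qed (use mem in auto)
  have detM: "det ?M = det M" by (rule det_reindex[OF g])
  have *: "finite (cube_solutions ?M (?\<phi> b))" "real (card (cube_solutions ?M (?\<phi> b))) = \<bar>det ?M\<bar>"
    using card_cube_solutions_wellorder[of ?M "?\<phi> b"] int det detM by auto
  show "finite (cube_solutions M b)" using bij * bij_betw_finite by blast
  show "real (card (cube_solutions M b)) = \<bar>det M\<bar>" using bij_betw_same_card[OF bij] * detM by simp
qed

lemma card_torus_solutions: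
  fixes M :: "real ^ 'n::finite ^ 'n" and P :: "'n torus set"
  assumes int: "\<And>i j. M $ i $ j \<in> \<int>" and det: "det M \<noteq> 0"
    and P: "\<And>x. abs_torus x \<in> P \<longleftrightarrow> (\<forall>r. (M *v x - b) $ r \<in> \<int>)"
  shows "finite P" "real (card P) = \<bar>det M\<bar>"
proof -
  have bij: "bij_betw abs_torus (cube_solutions M b) P"
    unfolding bij_betw_def
  proof (intro conjI equalityI subsetI)
    show "inj_on abs_torus (cube_solutions M b)"
    proof (rule inj_onI)
      fix x y assume "x \<in> cube_solutions M b" "y \<in> cube_solutions M b" "abs_torus x = abs_torus y"
      then have "frac_vec x = y" "frac_vec x = x"
        by (auto intro!: frac_vec_unique simp: cube_solutions_def abs_torus_eq_iff)
      then show "x = y" by simp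
    qed
    fix p assume p: "p \<in> P"
    obtain x where x: "p = abs_torus x" by (rule abs_torus_surj)
    have "frac_vec x \<in> cube_solutions M b"
      using p P x by (intro frac_vec_solution int) auto
    moreover have "abs_torus (frac_vec x) = p"
      unfolding x abs_torus_eq_iff using frac_vec_int by blast
    ultimately show "p \<in> abs_torus ` cube_solutions M b" by blast
  qed (use P in \<open>auto simp: cube_solutions_def\<close>)
  show "finite P" using bij card_cube_solutions(1)[OF int det] bij_betw_finite by blast
  show "real (card P) = \<bar>det M\<bar>"
    using bij_betw_same_card[OF bij] card_cube_solutions(2)[OF int det, of b] by simp
qed

lemma det_of_int: "det (\<chi> i j. real_of_int (B $ i $ j)) = of_int (det B)"
  by (simp add: det_def)

section \<open>Counting the regions\<close>

context toric_grid
begin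

text \<open>For independent normals, the intersection is the solution set of a linear congruence. For
dependent normals both sides are \<open>0\<close>, as general position makes the intersection empty.\<close>

lemma card_Inter_eq_abs_det:
  assumes S: "S \<subseteq> I" "card S = CARD('n)"
  shows "finite (\<Inter>(H ` S))" "int (card (\<Inter>(H ` S))) = abs_det_cols a S"
proof -
  have "finite S" using S(1) finite_I by (rule finite_subset)
  then obtain e :: "'n \<Rightarrow> 'i" where e: "bij_betw e UNIV S"
    using finite_same_card_bij[of "UNIV :: 'n set" S] S(2) by auto
  define B where "B = (\<chi> r c. a (e c) $ r)"
  define M where "M = (\<chi> r c. real_of_int (transpose B $ r $ c))"
  have detM: "det M = of_int (det B)" by (simp add: M_def det_of_int)
  have absdet: "abs_det_cols a S = \<bar>det B\<bar>" unfolding B_def by (rule abs_det_cols_eq[OF e])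
  have Mx: "(M *v x) $ r = real_vec (a (e r)) \<bullet> x" for x r
    by (simp add: M_def B_def transpose_def matrix_vector_mult_def inner_real_vec)
  have mem: "abs_torus x \<in> \<Inter>(H ` S) \<longleftrightarrow> (\<forall>r. (M *v x - (\<chi> r. \<beta> (e r))) $ r \<in> \<int>)" for x
  proof -
    have "abs_torus x \<in> \<Inter>(H ` S) \<longleftrightarrow> (\<forall>i\<in>S. real_vec (a i) \<bullet> x - \<beta> i \<in> \<int>)"
      using mem_H S(1) by blast
    also have "\<dots> \<longleftrightarrow> (\<forall>r. real_vec (a (e r)) \<bullet> x - \<beta> (e r) \<in> \<int>)"
      using bij_betw_imp_surj_on[OF e] by (metis (no_types, lifting) image_iff rangeI)
    finally show ?thesis by (simp add: Mx)
  qed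
  have "finite (\<Inter>(H ` S)) \<and> int (card (\<Inter>(H ` S))) = abs_det_cols a S"
  proof (cases "det B = 0")
    case False
    then have "finite (\<Inter>(H ` S))" "real (card (\<Inter>(H ` S))) = \<bar>det M\<bar>"
      using card_torus_solutions[of M "\<Inter>(H ` S)", OF _ _ mem] detM by (auto simp: M_def)
    then show ?thesis using absdet detM by (simp flip: of_int_abs)
  next
    case True
    have "\<Inter>(H ` S) = {}"
    proof (rule ccontr)
      assume "\<Inter>(H ` S) \<noteq> {}"
      then obtain p where p: "p \<in> \<Inter>(H ` S)" by blast
      obtain v where "p = abs_torus v" by (rule abs_torus_surj)
      then have "S = tight v" using S p tight_eq_if_mem by simp
      then have "dim ((\<lambda>i. real_vec (a i)) ` S) = DIM(real ^ 'n)" using S(2) dim_tight[of v] by simp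
      then have span: "span ((\<lambda>i. real_vec (a i)) ` S) = UNIV" by (simp only: dim_eq_full)
      have "x = 0" if "M *v x = 0" for x
      proof -
        have "real_vec (a (e r)) \<bullet> x = 0" for r using Mx[of x r] that by simp
        then have "orthogonal x y" if "y \<in> (\<lambda>i. real_vec (a i)) ` S" for y
          using that bij_betw_imp_surj_on[OF e] by (auto simp: orthogonal_def inner_commute)
        then have "orthogonal x x" using span orthogonal_to_span[where S = "(\<lambda>i. real_vec (a i)) ` S" and x = x and a = x] by blast
        then show "x = 0" by (simp add: orthogonal_self)
      qed
      then have "det M \<noteq> 0"
        by (metis invertible_det_nz invertible_left_inverse matrix_left_invertible_ker)
      then show False using detM True by simp
    qed
    then show ?thesis using True absdet by simp
  qed
  then show "finite (\<Inter>(H ` S))" "int (card (\<Inter>(H ` S))) = abs_det_cols a S" by auto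
qed

lemma card_regions:
  "int (card (components (UNIV - \<Union>(H ` I)))) = (\<Sum>S | S \<subseteq> I \<and> card S = CARD('n). abs_det_cols a S)"
  using card_vertices[OF card_Inter_eq_abs_det(1)] card_Inter_eq_abs_det(2)
  by (simp add: card_regions_eq_card_vertices)

end

theorem corollary5p2:
  fixes \<A> :: "'n::finite torus set set"
    and H :: "nat \<Rightarrow> 'n torus set"
    and a :: "nat \<Rightarrow> int ^ 'n"
    and m :: nat
  assumes "toric_arrangement \<A>"
    and "\<A> = H ` {1..m}" and "inj_on H {1..m}"
    and "m > CARD('n)"
    and "\<And>i. i \<in> {1..m} \<Longrightarrow> is_simple_hyperplane_with_normal (H i) (a i)"
    and "general_position \<A>"
    and "spanning \<A>"
  shows "int (num_regions \<A>) =
    (\<Sum>S | S \<subseteq> {1..m} \<and> card S = CARD('n). abs_det_cols a S)"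
proof -
  let ?\<alpha> = "\<lambda>i. real_vec (a i)"
  have "\<exists>b. \<forall>x. abs_torus x \<in> H i \<longleftrightarrow> ?\<alpha> i \<bullet> x - b \<in> \<int>" if "i \<in> {1..m}" for i
    using simple_hyperplane_lift[OF assms(5)[OF that]] by metis
  then obtain \<beta> where \<beta>: "\<And>i x. i \<in> {1..m} \<Longrightarrow> abs_torus x \<in> H i \<longleftrightarrow> ?\<alpha> i \<bullet> x - \<beta> i \<in> \<int>"
    by metis
  have gp: "general_position (H ` {1..m})" using assms by simp
  note tight = general_position_tight[OF gp finite_atLeastAtMost assms(3) \<beta>]
  have span: "span (?\<alpha> ` {1..m}) = UNIV"
  proof -
    obtain \<B> where \<B>: "\<B> \<subseteq> H ` {1..m}" "card \<B> = CARD('n)" "\<Inter>\<B> \<noteq> {}"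
      using assms(2,7) by (auto simp: spanning_def)
    then obtain S where S: "S \<subseteq> {1..m}" "\<B> = H ` S" by (meson subset_imageE)
    obtain p where p: "p \<in> \<Inter>\<B>" using \<B>(3) by blast
    obtain v where v: "p = abs_torus v" by (rule abs_torus_surj)
    let ?J = "{i\<in>{1..m}. ?\<alpha> i \<bullet> v - \<beta> i \<in> \<int>}"
    have "S \<subseteq> ?J"
    proof
      fix i assume "i \<in> S"
      then have "i \<in> {1..m}" "abs_torus v \<in> H i" using S p v by auto
      then show "i \<in> ?J" using \<beta> by blast
    qed
    then have "card S \<le> card ?J" by (intro card_mono) auto
    moreover have "card S = CARD('n)"
      using \<B>(2) card_image[OF inj_on_subset[OF assms(3) S(1)]] by (simp add: S(2))
    moreover have "dim (?\<alpha> ` ?J) = card ?J"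
      using dim_eq_card_independent[OF tight(1)] card_image[OF tight(2)] by metis
    moreover have "dim (?\<alpha> ` ?J) \<le> dim (?\<alpha> ` {1..m})" by (intro dim_subset image_mono) auto
    ultimately have "dim (?\<alpha> ` {1..m}) = DIM(real ^ 'n)"
      using dim_subset_UNIV[of "?\<alpha> ` {1..m}"] by simp
    then show ?thesis by (simp only: dim_eq_full)
  qed
  obtain w where w: "\<And>J. J \<subseteq> {1..m} \<Longrightarrow> dim (?\<alpha> ` J) < DIM(real ^ 'n) \<Longrightarrow> w \<notin> span (?\<alpha> ` J)"
    by (rule exists_generic_functional[of "{1..m}" ?\<alpha>]) auto
  interpret toric_grid "{1..m}" a \<beta> w H
    by unfold_locales (use span tight w \<beta> in auto)
  show ?thesis
    using card_regions by (simp add: num_regions_def assms(2))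
qed

end
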